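(* Let $\alpha\in\mathbb{R}$, let $r_1,r_2,r_3,r_4\ge0$ be integers, $r=r_1+r_2+r_3+r_4$, and let $n_1>\cdots>n_{r_1}\ge0$, $m_1>\cdots>m_{r_2}\ge0$, $m_1'>\cdots>m_{r_3}'\ge0$, $n_1'>\cdots>n_{r_4}'\ge0$ be integers. Let $f_j(x)=L^{(\alpha)}_{n_j}(x)$ ($1\le j\le r_1$), $f_{r_1+j}(x)=e^xL^{(\alpha)}_{m_j}(-x)$ ($1\le j\le r_2$), $f_{r_1+r_2+j}(x)=x^{-\alpha}L^{(-\alpha)}_{m_j'}(x)$ ($1\le j\le r_3$), $f_{r_1+r_2+r_3+j}(x)=e^xx^{-\alpha}L^{(-\alpha)}_{n_j'}(-x)$ ($1\le j\le r_4$). Consider the Maya diagrams $M_1:(n_1',\dots,n_{r_4}'\mid n_1,\dots,n_{r_1})$ and $M_2:(m_1',\dots,m_{r_3}'\mid m_1,\dots,m_{r_2})$, let $\lambda=\lambda(M_1)$, $\mu=\lambda(M_2)$ be the associated partitions with lengths $r(\lambda)$, $r(\mu)$, let $\lambda',\mu'$ be the conjugate partitions with lengths $r(\lambda')$, $r(\mu')$, and let $t_1=t(M_1)$, $t_2=t(M_2)$. Let $s\ge0$ be an integer. In (c) and (d), $n_1$ and $m_1$ denote the largest elements of $M_1$ and $M_2$, and $\alpha'=\alpha+n_1+m_1+2$. (a) If $s\ne n_i$ for $i=1,\dots,r_1$, then $n:=s+t_1+|\lambda|+|\mu|-r(\lambda)\in\mathbb{N}_{\lambda,\mu}$ and $$e^{-(r_2+r_4)x}x^{(\alpha+r_1+1+r_2)(r_3+r_4)}\cdot\mathrm{Wr}[f_1,\dots,f_r,L^{(\alpha)}_s(x)]=C_1L^{(\alpha-t_1-t_2)}_{\lambda,\mu,n}(x)$$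 for some constant $C_1$. (b) If $s\ne m_i$ for $i=1,\dots,r_2$, then $n:=s+t_2+|\lambda|+|\mu|-r(\mu)\in\mathbb{N}_{\mu,\lambda}$ and $$e^{-(r_2+1+r_4)x}x^{(\alpha+r_1+r_2+1)(r_3+r_4)}\cdot\mathrm{Wr}[f_1,\dots,f_r,e^xL^{(\alpha)}_s(-x)]=C_2L^{(\alpha-t_1-t_2)}_{\mu,\lambda,n}(-x)$$ for some constant $C_2$. (c) If $s\ne m_i'$ for $i=1,\dots,r_3$, then $n:=s+m_1+1+|\lambda|+|\mu|-r(\mu')\in\mathbb{N}_{\mu',\lambda'}$ and $$e^{-(r_2+r_4)x}x^{(\alpha+r_1+r_2)(r_3+1+r_4)}\cdot\mathrm{Wr}[f_1,\dots,f_r,x^{-\alpha}L^{(-\alpha)}_s(x)]=C_3L^{(-\alpha')}_{\mu',\lambda',n}(x)$$ for some constant $C_3$. (d) If $s\ne n_i'$ for $i=1,\dots,r_4$, then $n:=s+n_1+1+|\lambda|+|\mu|-r(\lambda')\in\mathbb{N}_{\lambda',\mu'}$ and $$e^{-(r_2+r_4+1)x}x^{(\alpha+r_1+r_2)(r_3+r_4+1)}\cdot\mathrm{Wr}[f_1,\dots,f_r,e^xx^{-\alpha}L^{(-\alpha)}_s(-x)]=C_4L^{(-\alpha')}_{\lambda',\mu',n}(-x)$$ for some constant $C_4$.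
   Context: For $\alpha\in\mathbb{R}$ and an integer $n\ge 0$, $L^{(\alpha)}_n(x)=\frac{e^x x^{-\alpha}}{n!}\frac{d^n}{dx^n}\left(e^{-x}x^{n+\alpha}\right)$ is the Laguerre polynomial of degree $n$ (so $L_n^{(\alpha)}(x)=\sum_{k=0}^n\binom{n+\alpha}{n-k}\frac{(-x)^k}{k!}$). Powers such as $x^{-\alpha}$ are taken for $x>0$. "Constant" means independent of $x$ (it may depend on $\alpha$, $s$, $M_1$, $M_2$). $\mathrm{Wr}[f_1,\dots,f_r]=\det\left(\frac{d^{j-1}}{dx^{j-1}}f_i\right)_{1\le i,j\le r}$ is the Wronskian, as a function of $x$. A partition $\lambda=(\lambda_1,\dots,\lambda_{p})$ is a weakly decreasing (possibly empty) finite sequence of positive integers; $p=r(\lambda)$ is its length and $|\lambda|=\sum_j\lambda_j$. The conjugate partition $\lambda'$ is $\lambda'_i=\#\{j:\lambda_j\ge i\}$, $i=1,\dots,\lambda_1$. For partitions $\lambda$ of length $p$ and $\mu$ of length $q$, the degree sequence is $$\mathbb{N}_{\lambda,\mu}=\{n\in\{0,1,2,\dots\}: n\ge|\lambda|+|\mu|-p\text{ and }n-|\lambda|-|\mu|\ne\lambda_j-j\text{ for }j=1,\dots,p\},$$ and for $\beta\in\mathbb{R}$ and $n\in\mathbb{N}_{\lambda,\mu}$ the exceptional Laguerre polynomial is $$L^{(\beta)}_{\lambda,\mu,n}(x)=e^{-qx}\,\mathrm{Wr}\left[g_1,\dots,g_{p+q},L^{(\beta)}_{\sigma}\right](x),\qquad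 \sigma=n-|\lambda|-|\mu|+p,$$ where $g_j(x)=L^{(\beta)}_{\lambda_j+p-j}(x)$ for $1\le j\le p$ and $g_{p+j}(x)=e^xL^{(\beta)}_{\mu_j+q-j}(-x)$ for $1\le j\le q$. A Maya diagram is a set $M\subset\mathbb{Z}$ containing only finitely many non-negative integers and all but finitely many negative integers. It is encoded as $M:(n_1',\dots,n_b'\mid n_1,\dots,n_a)$, where $n_1>\cdots>n_a\ge0$ are the non-negative elements of $M$ and $n_1'>\cdots>n_b'\ge0$ are the numbers $n'=-k-1$ for the negative integers $k\notin M$. For $t\in\mathbb{Z}$, $M+t=\{k+t:k\in M\}$. The integer $t(M)$ is the unique $t$ such that $M+t$ contains all negative integers and does not contain $0$. If $N_1>\cdots>N_p\ge1$ are the non-negative elements of $M+t(M)$, then $\lambda(M)$ is the partition with $\lambda_j=N_j-p+j$, $j=1,\dots,p$. *)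

theory Defs
  imports "HOL-Analysis.Derivative" "Jordan_Normal_Form.Determinant"
begin

section \<open>Laguerre polynomials\<close>

text \<open>The explicit sum is the definition because it makes sense on the whole real line; for
  positive arguments lemma \<open>laguerre_Rodrigues\<close> recovers the Rodrigues formula.\<close>

definition laguerre :: "real \<Rightarrow> nat \<Rightarrow> real \<Rightarrow> real" where
  "laguerre \<alpha> n x = (\<Sum>k\<le>n. ((real n + \<alpha>) gchoose (n - k)) * (- x) ^ k / fact k)"

lemma higher_deriv_exp_powr:
  fixes b x :: real
  assumes "x > 0"
  shows "(deriv ^^ m) (\<lambda>x. exp (- x) * x powr b) x =
    (- 1) ^ m * exp (- x) *
      (\<Sum>j\<le>m. real (m choose j) * ((- 1) ^ j * fact j * (b gchoose j) * x powr (b - real j)))"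
  using assms
proof (induction m arbitrary: x)
  case 0
  then show ?case by simp
next
  case (Suc m)
  define G where "G = (\<lambda>j (x::real). (- 1) ^ j * fact j * (b gchoose j) * x powr (b - real j))"
  define S where "S = (\<lambda>m x. \<Sum>j\<le>m. real (m choose j) * G j x)"
  have dG: "(G j has_real_derivative - G (Suc j) x) (at x)" for j
  proof -
    have *: "(G j has_real_derivative
        (- 1) ^ j * fact j * (b gchoose j) * ((b - real j) * x powr (b - real j - 1))) (at x)"
      unfolding G_def using \<open>x > 0\<close>
      by (intro DERIV_cmult has_real_derivative_powr) auto
    have "(b - real j) * (b gchoose j) = real (Suc j) * (b gchoose Suc j)"
      by (simp only: gbinomial_absorb_comp gbinomial_absorption)
    moreover have "(- 1) ^ j * fact j * (b gchoose j) * ((b - real j) * x powr (b - real j - 1))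
        = (- 1) ^ j * fact j * ((b - real j) * (b gchoose j)) * x powr (b - real (Suc j))"
      by (simp add: algebra_simps)
    ultimately have "(- 1) ^ j * fact j * (b gchoose j) * ((b - real j) * x powr (b - real j - 1))
        = - G (Suc j) x"
      unfolding G_def by (simp only: fact_Suc power_Suc of_nat_mult) simp
    with * show ?thesis by simp
  qed
  have dS: "(S m has_real_derivative (\<Sum>j\<le>m. real (m choose j) * - G (Suc j) x)) (at x)"
    unfolding S_def by (intro DERIV_sum DERIV_cmult dG)
  have pascal: "S m x + (\<Sum>j\<le>m. real (m choose j) * G (Suc j) x) = S (Suc m) x"
  proof -
    have "S (Suc m) x = G 0 x + (\<Sum>j\<le>m. real (Suc m choose Suc j) * G (Suc j) x)"
      unfolding S_def by (subst sum.atMost_Suc_shift) simp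
    also have "\<dots> = (G 0 x + (\<Sum>j\<le>m. real (m choose Suc j) * G (Suc j) x))
        + (\<Sum>j\<le>m. real (m choose j) * G (Suc j) x)"
      by (simp add: algebra_simps sum.distrib)
    also have "G 0 x + (\<Sum>j\<le>m. real (m choose Suc j) * G (Suc j) x)
        = (\<Sum>j\<le>Suc m. real (m choose j) * G j x)"
      by (subst sum.atMost_Suc_shift) simp
    also have "\<dots> = S m x"
      by (simp add: S_def)
    finally show ?thesis by simp
  qed
  have "\<forall>\<^sub>F y in nhds x. y > 0"
    using \<open>x > 0\<close> by (intro eventually_nhds_in_open[of "{0<..}" x, simplified]) auto
  then have "\<forall>\<^sub>F y in nhds x. (deriv ^^ m) (\<lambda>x. exp (- x) * x powr b) y
      = (- 1) ^ m * exp (- y) * S m y"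
    by eventually_elim (simp add: Suc.IH S_def G_def)
  then have "(deriv ^^ Suc m) (\<lambda>x. exp (- x) * x powr b) x
      = deriv (\<lambda>y. (- 1) ^ m * exp (- y) * S m y) x"
    by (simp add: deriv_cong_ev)
  also have "\<dots> = (- 1) ^ Suc m * exp (- x) * S (Suc m) x"
    by (rule DERIV_imp_deriv)
      (auto intro!: derivative_eq_intros dS simp: pascal [symmetric] sum_negf algebra_simps)
  finally show ?case
    by (simp add: S_def G_def)
qed

lemma laguerre_Rodrigues:
  assumes "x > 0"
  shows "laguerre \<alpha> n x = exp x * x powr (- \<alpha>) / fact n *
    (deriv ^^ n) (\<lambda>x. exp (- x) * x powr (real n + \<alpha>)) x"
proof -
  let ?s = "\<lambda>j. real (n choose j) *
      ((- 1) ^ j * fact j * ((real n + \<alpha>) gchoose j) * x powr (real n + \<alpha> - real j))"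
  have "exp x * x powr (- \<alpha>) / fact n * (deriv ^^ n) (\<lambda>x. exp (- x) * x powr (real n + \<alpha>)) x
    = (\<Sum>j\<le>n. x powr (- \<alpha>) / fact n * (- 1) ^ n * (real (n choose j) *
        ((- 1) ^ j * fact j * ((real n + \<alpha>) gchoose j) * x powr (real n + \<alpha> - real j))))"
    using assms
  proof -
    have "exp x * x powr (- \<alpha>) / fact n * (deriv ^^ n) (\<lambda>x. exp (- x) * x powr (real n + \<alpha>)) x
      = exp x * x powr (- \<alpha>) / fact n * ((- 1) ^ n * exp (- x) * (\<Sum>j\<le>n. ?s j))"
      using higher_deriv_exp_powr [OF assms, of n "real n + \<alpha>"] by (rule arg_cong)
    also have "\<dots> = (exp x * exp (- x)) * (x powr (- \<alpha>) / fact n * (- 1) ^ n * (\<Sum>j\<le>n. ?s j))"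
      by (simp only: times_divide_eq_left times_divide_eq_right mult_ac)
    also have "\<dots> = (\<Sum>j\<le>n. x powr (- \<alpha>) / fact n * (- 1) ^ n * ?s j)"
      by (simp only: exp_minus_inverse sum_distrib_left mult_1)
    finally show ?thesis .
  qed
  also have "\<dots> = (\<Sum>j\<le>n. ((real n + \<alpha>) gchoose j) * (- x) ^ (n - j) / fact (n - j))"
  proof (rule sum.cong)
    fix j assume "j \<in> {..n}"
    then have j: "j \<le> n" by simp
    have "x powr (- \<alpha>) * x powr (real n + \<alpha> - real j) = x powr real (n - j)"
      using j by (simp add: powr_add [symmetric] of_nat_diff)
    then have 1: "x powr (- \<alpha>) * x powr (real n + \<alpha> - real j) = x ^ (n - j)"
      using assms by (simp add: powr_realpow)
    have 2: "real (n choose j) * fact j / fact n = 1 / fact (n - j)"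
      using j by (simp add: binomial_fact)
    have 3: "(- 1 :: real) ^ n * (- 1) ^ j = (- 1) ^ (n - j)"
      using j by (simp add: power_add [symmetric] minus_one_power_iff)
    have "x powr (- \<alpha>) / fact n * (- 1) ^ n * (real (n choose j) *
        ((- 1) ^ j * fact j * ((real n + \<alpha>) gchoose j) * x powr (real n + \<alpha> - real j)))
      = ((- 1) ^ n * (- 1) ^ j) * (real (n choose j) * fact j / fact n)
        * ((real n + \<alpha>) gchoose j) * (x powr (- \<alpha>) * x powr (real n + \<alpha> - real j))"
      by simp
    also have "\<dots> = ((real n + \<alpha>) gchoose j) * (- x) ^ (n - j) / fact (n - j)"
      unfolding 1 2 3 by (subst (2) power_minus) simp
    finally show "x powr (- \<alpha>) / fact n * (- 1) ^ n * (real (n choose j) *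
        ((- 1) ^ j * fact j * ((real n + \<alpha>) gchoose j) * x powr (real n + \<alpha> - real j)))
      = ((real n + \<alpha>) gchoose j) * (- x) ^ (n - j) / fact (n - j)" .
  qed simp
  also have "\<dots> = laguerre \<alpha> n x"
    unfolding laguerre_def
    by (rule sum.reindex_bij_witness [of _ "\<lambda>k. n - k" "\<lambda>k. n - k"]) auto
  finally show ?thesis ..
qed

definition wronskian :: "(real \<Rightarrow> real) list \<Rightarrow> real \<Rightarrow> real" where
  "wronskian fs x =
    det (mat (length fs) (length fs) (\<lambda>(i, j). (deriv ^^ j) (fs ! i) x))"


section \<open>Partitions\<close>

text \<open>A partition \<open>\<lambda>\<close> is a list of natural numbers; the part \<open>\<lambda>\<^sub>j\<close> with \<open>j \<ge> 1\<close> is \<open>la ! (j - 1)\<close>,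
  its length is \<^const>\<open>length\<close> and \<open>|\<lambda>|\<close> is \<^const>\<open>sum_list\<close>.\<close>

definition is_partition :: "nat list \<Rightarrow> bool" where
  "is_partition la \<longleftrightarrow> sorted_wrt (\<ge>) la \<and> (\<forall>k\<in>set la. k > 0)"

definition conj_partition :: "nat list \<Rightarrow> nat list" where
  "conj_partition la =
    map (\<lambda>i. card {j \<in> {1..length la}. la ! (j - 1) \<ge> i})
      [1..<(case la of [] \<Rightarrow> 0 | l # _ \<Rightarrow> l) + 1]"


section \<open>Exceptional Laguerre polynomials\<close>

definition degree_seq :: "nat list \<Rightarrow> nat list \<Rightarrow> nat set" where
  "degree_seq la mu = {n.
     int n \<ge> int (sum_list la) + int (sum_list mu) - int (length la) \<and>
     (\<forall>j\<in>{1..length la}.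
        int n - int (sum_list la) - int (sum_list mu) \<noteq> int (la ! (j - 1)) - int j)}"

text \<open>For \<open>n \<in> degree_seq la mu\<close> the natural-number subtraction in the index \<open>\<sigma>\<close> is exact.\<close>

definition exceptional_laguerre :: "real \<Rightarrow> nat list \<Rightarrow> nat list \<Rightarrow> nat \<Rightarrow> real \<Rightarrow> real" where
  "exceptional_laguerre \<beta> la mu n x =
    (let p = length la; q = length mu;
         \<sigma> = n + p - (sum_list la + sum_list mu)
     in exp (- real q * x) *
        wronskian
          (map (\<lambda>j. laguerre \<beta> (la ! (j - 1) + p - j)) [1..<p + 1] @
           map (\<lambda>j x. exp x * laguerre \<beta> (mu ! (j - 1) + q - j) (- x)) [1..<q + 1] @
           [laguerre \<beta> \<sigma>]) x)"


section \<open>Maya diagrams\<close>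

definition maya_diagram :: "int set \<Rightarrow> bool" where
  "maya_diagram M \<longleftrightarrow> finite {k \<in> M. k \<ge> 0} \<and> finite {k. k < 0 \<and> k \<notin> M}"

text \<open>\<open>maya_of ns' ns\<close> is the diagram with encoding \<open>(ns' | ns)\<close>.\<close>

definition maya_of :: "nat list \<Rightarrow> nat list \<Rightarrow> int set" where
  "maya_of ns' ns = int ` set ns \<union> {k. k < 0 \<and> - k - 1 \<notin> int ` set ns'}"

definition maya_shift :: "int set \<Rightarrow> int \<Rightarrow> int set" where
  "maya_shift M t = (\<lambda>k. k + t) ` M"

definition maya_t :: "int set \<Rightarrow> int" where
  "maya_t M = (THE t. {..<0} \<subseteq> maya_shift M t \<and> 0 \<notin> maya_shift M t)"

definition maya_partition :: "int set \<Rightarrow> nat list" where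
  "maya_partition M =
    (let N = rev (sorted_list_of_set {k \<in> maya_shift M (maya_t M). k \<ge> 0}); p = length N
     in map (\<lambda>j. nat (N ! (j - 1) - int p + int j)) [1..<p + 1])"

text \<open>Diagrams are infinite, so \<^const>\<open>Max\<close> is not available for the largest element.\<close>

definition maya_largest :: "int set \<Rightarrow> int" where
  "maya_largest M = (GREATEST k. k \<in> M)"

lemma maya_diagram_maya_of: "maya_diagram (maya_of ns' ns)"
proof -
  have "{k \<in> maya_of ns' ns. k \<ge> 0} \<subseteq> int ` set ns"
    by (auto simp: maya_of_def)
  moreover have "{k. k < 0 \<and> k \<notin> maya_of ns' ns} \<subseteq> (\<lambda>n. - int n - 1) ` set ns'"
    by (force simp: maya_of_def)
  ultimately show ?thesis
    unfolding maya_diagram_def by (meson finite_imageI finite_set finite_subset)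
qed

lemma maya_diagram_bounds:
  assumes "maya_diagram M"
  obtains a b where "\<And>k. k < a \<Longrightarrow> k \<in> M" "\<And>k. k \<in> M \<Longrightarrow> k \<le> b" "a \<in> M" "a < 0" "b \<ge> 0"
proof -
  define A where "A = {k. k < 0 \<and> k \<notin> M}"
  define B where "B = {k \<in> M. k \<ge> 0}"
  have "finite A" "finite B"
    using assms by (auto simp: maya_diagram_def A_def B_def)
  define a where "a = Min (insert 0 A) - 1"
  define b where "b = Max (insert 0 B)"
  have a: "a < k" if "k \<in> insert 0 A" for k
    using Min_le [OF finite.insertI [OF \<open>finite A\<close>] that] unfolding a_def by linarith
  have b: "k \<le> b" if "k \<in> insert 0 B" for k
    using Max_ge [OF finite.insertI [OF \<open>finite B\<close>] that] unfolding b_def by linarith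
  have "a < 0" "b \<ge> 0" using a [of 0] b [of 0] by auto
  have 1: "k \<in> M" if "k \<le> a" for k
    using a [of k] that \<open>a < 0\<close> by (force simp: A_def)
  have 2: "k \<le> b" if "k \<in> M" for k
    using b [of k] that \<open>b \<ge> 0\<close> by (force simp: B_def)
  show thesis
    using that [of a b] 1 2 \<open>a < 0\<close> \<open>b \<ge> 0\<close> by simp
qed

lemma maya_t_ex1:
  assumes "maya_diagram M"
  shows "\<exists>!t. {..<0} \<subseteq> maya_shift M t \<and> 0 \<notin> maya_shift M t"
proof -
  obtain a b where ab: "\<And>k. k < a \<Longrightarrow> k \<in> M" "\<And>k. k \<in> M \<Longrightarrow> k \<le> b" "a < 0" "b \<ge> 0"
    using maya_diagram_bounds [OF assms] by metis
  have mem: "k \<in> maya_shift M t \<longleftrightarrow> k - t \<in> M" for k t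
    unfolding maya_shift_def by (force simp: image_iff)
  define n where "n = (LEAST n. a + int n \<notin> M)"
  have "a + int (nat (b + 1 - a)) \<notin> M"
    using ab(2) [of "b + 1"] ab(3,4) by auto
  then have n: "a + int n \<notin> M"
    unfolding n_def by (rule LeastI)
  have below: "k \<in> M" if "k < a + int n" for k
  proof (cases "k < a")
    case False
    then have "nat (k - a) < n" using that by linarith
    then have "a + int (nat (k - a)) \<in> M"
      unfolding n_def using not_less_Least by blast
    then show ?thesis using False by simp
  qed (use ab in auto)
  show ?thesis
  proof (rule ex1I [of _ "- (a + int n)"])
    show "{..<0} \<subseteq> maya_shift M (- (a + int n)) \<and> 0 \<notin> maya_shift M (- (a + int n))"
    proof (intro conjI subsetI)
      fix k :: int assume "k \<in> {..<0}"
      then have "k - - (a + int n) < a + int n" by simp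
      then show "k \<in> maya_shift M (- (a + int n))"
        unfolding mem by (rule below)
    next
      have "0 - - (a + int n) = a + int n" by simp
      then show "0 \<notin> maya_shift M (- (a + int n))"
        unfolding mem using n by argo
    qed
  next
    fix t assume t: "{..<0} \<subseteq> maya_shift M t \<and> 0 \<notin> maya_shift M t"
    then have "- t \<notin> M" by (simp add: mem)
    moreover have "k \<in> M" if "k < - t" for k
    proof -
      have "k + t \<in> maya_shift M t" using t that by auto
      then show ?thesis by (simp add: mem)
    qed
    ultimately have "\<not> - t < a + int n" "\<not> a + int n < - t"
      using n below by blast+
    then show "t = - (a + int n)"
      by linarith
  qed
qed

lemma maya_largest:
  assumes "maya_diagram M"
  shows "maya_largest M \<in> M" and "k \<in> M \<Longrightarrow> k \<le> maya_largest M"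
proof -
  obtain a b where ab: "\<And>k. k \<in> M \<Longrightarrow> k \<le> b" "a \<in> M"
    using maya_diagram_bounds [OF assms] by metis
  have "finite (M \<inter> {a..b})" "M \<inter> {a..b} \<noteq> {}"
    using ab by auto
  from Max_in [OF this] Max_ge [OF this(1)]
  have m: "Max (M \<inter> {a..b}) \<in> M \<inter> {a..b}" "\<And>k. k \<in> M \<inter> {a..b} \<Longrightarrow> k \<le> Max (M \<inter> {a..b})"
    by simp_all
  define g where "g = Max (M \<inter> {a..b})"
  have g: "g \<in> M" "\<And>k. k \<in> M \<Longrightarrow> k \<le> g"
  proof -
    show "g \<in> M" using m(1) by (simp add: g_def)
    fix k assume "k \<in> M"
    then show "k \<le> g"
      using m ab(1) [of k] unfolding g_def [symmetric] by (cases "k \<ge> a") auto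
  qed
  have "maya_largest M = g"
    unfolding maya_largest_def using g by (rule Greatest_equality)
  then show "maya_largest M \<in> M" and "k \<in> M \<Longrightarrow> k \<le> maya_largest M"
    using g by auto
qed

lemma is_partition_maya_partition:
  assumes "maya_diagram M"
  shows "is_partition (maya_partition M)"
proof -
  obtain a b where ab: "\<And>k. k \<in> M \<Longrightarrow> k \<le> b"
    using maya_diagram_bounds [OF assms] by metis
  define t where "t = maya_t M"
  define A where "A = {k \<in> maya_shift M t. k \<ge> 0}"
  define N where "N = rev (sorted_list_of_set A)"
  define p where "p = length N"
  have "0 \<notin> maya_shift M t"
    using theI' [OF maya_t_ex1 [OF assms]] unfolding t_def maya_t_def by auto
  have A: "A \<subseteq> {1..b + t}"
  proof
    fix k assume k: "k \<in> A"
    then obtain m where "m \<in> M" "k = m + t"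
      by (auto simp: A_def maya_shift_def)
    moreover have "k \<noteq> 0" "k \<ge> 0"
      using k \<open>0 \<notin> maya_shift M t\<close> by (auto simp: A_def)
    ultimately show "k \<in> {1..b + t}"
      using ab [of m] by simp
  qed
  then have "finite A" by (rule finite_subset) simp
  then have set_N: "set N = A" and N: "sorted_wrt (>) N"
    by (auto simp: N_def sorted_wrt_rev strict_sorted_list_of_set)
  have step: "N ! j + int j \<le> N ! i + int i" if "i \<le> j" "j < p" for i j
    using that
  proof (induction j rule: dec_induct)
    case (step j)
    then show ?case
      using sorted_wrt_nth_less [OF N, of j "Suc j"] by (auto simp: p_def)
  qed simp
  have pos: "N ! i + int i \<ge> int p" if "i < p" for i
  proof -
    have "N ! (p - 1) \<in> A"
      using that set_N nth_mem [of "p - 1" N] by (auto simp: p_def)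
    then have "N ! (p - 1) \<ge> 1"
      using A by auto
    moreover have "N ! (p - 1) + int (p - 1) \<le> N ! i + int i"
      using step [of i "p - 1"] that by simp
    ultimately show ?thesis
      using that by linarith
  qed
  have eq: "maya_partition M = map (\<lambda>j. nat (N ! (j - 1) - int p + int j)) [1..<p + 1]"
    by (simp add: maya_partition_def Let_def N_def A_def t_def p_def)
  have nth: "maya_partition M ! i = nat (N ! i - int p + int i + 1)" if "i < p" for i
    using that by (simp add: eq add.commute del: upt_Suc)
  have len: "length (maya_partition M) = p"
    by (simp add: eq)
  show ?thesis
    unfolding is_partition_def sorted_wrt_iff_nth_less all_set_conv_all_nth len
  proof (intro conjI allI impI)
    fix i j assume "i < j" "j < p"
    then show "maya_partition M ! i \<ge> maya_partition M ! j"
      using step [of i j] by (simp add: nth)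
  next
    fix i assume "i < p"
    then show "maya_partition M ! i > 0"
      using pos [of i] by (simp add: nth)
  qed
qed

end

theory Submission
  imports Defs "HOL-Combinatorics.Permutations" "HOL-Computational_Algebra.Polynomial"
begin

text \<open>
  Attach to a pair of Maya diagrams the Wronskian of its seed functions, with the prefactor that makes
  it invariant (up to constants) under multiplying all seeds by \<open>x\<^sup>\<alpha>\<close> or \<open>e\<^sup>-\<^sup>x\<close>. The identity
  \<open>Wr[1, f\<^sub>2, \<dots>] = Wr[f\<^sub>2', \<dots>]\<close> and the derivative formulas of Laguerre polynomials show that shifting
  either diagram by one and replacing \<open>\<alpha>\<close> by \<open>\<alpha> - 1\<close> changes this function only by a constant, which is
  nonzero for \<open>\<alpha> \<notin> \<int>\<close>. Regarding \<open>s\<close> as an additional element of the diagram and shifting to standard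
  position gives (a) for \<open>\<alpha> \<notin> \<int>\<close>. Both sides are continuous in \<open>\<alpha>\<close>, and the standard Wronskian never
  vanishes identically because its seeds have pairwise different growth at infinity, so the identity
  extends to all \<open>\<alpha>\<close>. The symmetries \<open>x \<mapsto> -x\<close> and \<open>\<alpha> \<mapsto> -\<alpha>\<close> permute the four types of seeds; the latter
  replaces the diagrams by their conjugates. They turn (a) into (b), (c) and (d).
\<close>

section \<open>Smooth functions on an open set\<close>

text \<open>Differentiation dictates how the seed types pair up into two diagrams: it raises the
  parameter by one, lowers the degrees of type one, raises those of type four and keeps those of
  types two and three. With a degree of type four read as the empty position -n'-1, this translates
  the first diagram, and the eliminated constant is the element at 0 crossing to the negative side.
  Integral \<alpha> is a genuine obstacle: there L_n^(a) and x^(-a) L_m^(-a) can be linearly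
  dependent, for instance for a = 0 and n = m, so the left side may vanish identically and no chain
  of reversible steps can exist. The target Wronskian contains only types one and two, whose leading
  coefficients do not involve the parameter; it stays nonzero and can serve as the denominator of
  the constant in the limit. No constant is tracked: signs of permutations and factors from
  differentiation all disappear in an existential.\<close>

definition smooth_on :: "real set \<Rightarrow> (real \<Rightarrow> real) \<Rightarrow> bool" where
  "smooth_on S f \<longleftrightarrow> (\<forall>j. \<forall>x\<in>S. (deriv ^^ j) f differentiable at x)"

lemma smooth_on_subset: "smooth_on S f \<Longrightarrow> T \<subseteq> S \<Longrightarrow> smooth_on T f"
  by (auto simp: smooth_on_def)

lemma smooth_on_DERIV:
  assumes "smooth_on S f" "x \<in> S"
  shows "((deriv ^^ j) f has_real_derivative (deriv ^^ Suc j) f x) (at x)"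
proof -
  have "(deriv ^^ j) f differentiable at x"
    using assms by (simp add: smooth_on_def)
  then show ?thesis
    by (auto simp: real_differentiable_def dest: DERIV_imp_deriv)
qed

lemma higher_deriv_cong_on:
  assumes "open S" "\<And>y. y \<in> S \<Longrightarrow> f y = g y" "x \<in> S"
  shows "(deriv ^^ j) f x = (deriv ^^ j) g x"
proof (rule higher_deriv_cong_ev)
  show "\<forall>\<^sub>F y in nhds x. f y = g y"
    using eventually_nhds_in_open [OF assms(1,3)] by eventually_elim (rule assms(2))
qed simp

lemma higher_deriv_closed_class:
  assumes "open S" "P f"
    and step: "\<And>g. P g \<Longrightarrow> \<exists>h. P h \<and> (\<forall>x\<in>S. (g has_real_derivative h x) (at x))"
  shows "\<exists>g. P g \<and> (\<forall>x\<in>S. (deriv ^^ j) f x = g x)"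
proof (induction j)
  case 0
  then show ?case using assms(2) by auto
next
  case (Suc j)
  then obtain g where g: "P g" "\<And>x. x \<in> S \<Longrightarrow> (deriv ^^ j) f x = g x" by auto
  from step [OF g(1)] obtain h where h: "P h" "\<And>x. x \<in> S \<Longrightarrow> (g has_real_derivative h x) (at x)"
    by auto
  have "(deriv ^^ Suc j) f x = h x" if "x \<in> S" for x
    using higher_deriv_cong_on [of S "(deriv ^^ j) f" g x 1] g(2) assms(1) that
      DERIV_imp_deriv [OF h(2) [OF that]] by simp
  with h(1) show ?case by auto
qed

lemma differentiable_cong_on:
  fixes f g :: "real \<Rightarrow> real"
  assumes "open S" "x \<in> S" "\<And>y. y \<in> S \<Longrightarrow> f y = g y" "g differentiable at x"
  shows "f differentiable at x"
proof -
  obtain D where "(g has_real_derivative D) (at x)"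
    using assms(4) by (auto simp: real_differentiable_def)
  then have "(f has_real_derivative D) (at x)"
    by (rule has_field_derivative_transform_within_open) (use assms in auto)
  then show ?thesis by (auto simp: real_differentiable_def)
qed

text \<open>Only a single derivative inside the class has to be exhibited, so no formula for higher
  derivatives is needed. The classes used are the constants, sums of exponentials times powers, and
  exponentials times rational functions.\<close>

lemma smooth_on_closed_class:
  assumes "open S" "P f"
    and step: "\<And>g. P g \<Longrightarrow> \<exists>h. P h \<and> (\<forall>x\<in>S. (g has_real_derivative h x) (at x))"
  shows "smooth_on S f"
  unfolding smooth_on_def
proof (intro allI ballI)
  fix j x assume x: "x \<in> S"
  obtain g where g: "P g" "\<And>x. x \<in> S \<Longrightarrow> (deriv ^^ j) f x = g x"
    using higher_deriv_closed_class [of S P f j] assms by blast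
  have "g differentiable at x"
    using step [OF g(1)] x by (auto simp: real_differentiable_def)
  with g(2) x show "(deriv ^^ j) f differentiable at x"
    using differentiable_cong_on [OF assms(1)] by blast
qed

lemma smooth_on_cong:
  assumes "open S" "\<And>y. y \<in> S \<Longrightarrow> f y = g y" "smooth_on S g"
  shows "smooth_on S f"
  unfolding smooth_on_def
proof (intro allI ballI)
  fix j x assume "x \<in> S"
  then show "(deriv ^^ j) f differentiable at x"
    using assms higher_deriv_cong_on [of S f g _ j]
    by (intro differentiable_cong_on [of S x "(deriv ^^ j) f" "(deriv ^^ j) g"])
      (auto simp: smooth_on_def)
qed

lemma higher_deriv_mult_on:
  assumes "open S" "smooth_on S f" "smooth_on S g" "x \<in> S"
  shows "(deriv ^^ n) (\<lambda>y. f y * g y) x =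
    (\<Sum>i\<le>n. real (n choose i) * (deriv ^^ i) f x * (deriv ^^ (n - i)) g x)"
  using assms(4)
proof (induction n arbitrary: x)
  case 0
  then show ?case by simp
next
  case (Suc n)
  let ?f = "\<lambda>i. (deriv ^^ i) f x" and ?g = "\<lambda>i. (deriv ^^ i) g x"
  note D = smooth_on_DERIV [OF assms(2) Suc.prems] smooth_on_DERIV [OF assms(3) Suc.prems]
  have "(deriv ^^ Suc n) (\<lambda>y. f y * g y) x =
      deriv (\<lambda>y. \<Sum>i\<le>n. real (n choose i) * (deriv ^^ i) f y * (deriv ^^ (n - i)) g y) x"
    using higher_deriv_cong_on [OF assms(1) Suc.IH Suc.prems, where j = 1] by simp
  also have "\<dots> = (\<Sum>i\<le>n. real (n choose i) * (?f (Suc i) * ?g (n - i) + ?f i * ?g (Suc (n - i))))"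
    by (rule DERIV_imp_deriv)
      (auto intro!: derivative_eq_intros D sum.cong simp del: funpow.simps simp: algebra_simps)
  also have "\<dots> = (\<Sum>i\<le>n. real (n choose i) * (?f (Suc i) * ?g (n - i)))
      + (\<Sum>i\<le>n. real (n choose i) * (?f i * ?g (Suc n - i)))"
    by (simp add: algebra_simps sum.distrib Suc_diff_le del: funpow.simps)
  also have "(\<Sum>i\<le>n. real (n choose i) * (?f i * ?g (Suc n - i)))
      = (\<Sum>i\<le>Suc n. real (n choose i) * (?f i * ?g (Suc n - i)))"
    by simp
  also have "\<dots> = ?f 0 * ?g (Suc n) + (\<Sum>i\<le>n. real (n choose Suc i) * (?f (Suc i) * ?g (n - i)))"
    by (subst sum.atMost_Suc_shift) (simp del: funpow.simps)
  also have "(\<Sum>i\<le>n. real (n choose i) * (?f (Suc i) * ?g (n - i))) + \<dots> =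
      ?f 0 * ?g (Suc n) + (\<Sum>i\<le>n. real (Suc n choose Suc i) * (?f (Suc i) * ?g (n - i)))"
    by (simp add: algebra_simps sum.distrib del: funpow.simps)
  also have "\<dots> = (\<Sum>i\<le>Suc n. real (Suc n choose i) * ?f i * ?g (Suc n - i))"
    by (subst sum.atMost_Suc_shift) (simp add: mult.assoc del: funpow.simps)
  finally show ?case .
qed

lemma smooth_on_const [simp]: "smooth_on S (\<lambda>x. c)"
proof -
  have "smooth_on UNIV (\<lambda>x. c)"
    by (rule smooth_on_closed_class [where P = "\<lambda>f. \<exists>c. f = (\<lambda>x. c)"]) (auto intro!: exI [of _ "\<lambda>x. 0"])
  then show ?thesis by (rule smooth_on_subset) simp
qed

lemma higher_deriv_cmult_on:
  assumes "open S" "smooth_on S f" "x \<in> S"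
  shows "(deriv ^^ n) (\<lambda>y. c * f y) x = c * (deriv ^^ n) f x"
  using assms(3)
proof (induction n arbitrary: x)
  case (Suc n)
  have "(deriv ^^ Suc n) (\<lambda>y. c * f y) x = deriv (\<lambda>y. c * (deriv ^^ n) f y) x"
    using higher_deriv_cong_on [OF assms(1) Suc.IH Suc.prems, where j = 1] by simp
  also have "\<dots> = c * (deriv ^^ Suc n) f x"
    by (rule DERIV_imp_deriv) (rule DERIV_cmult [OF smooth_on_DERIV [OF assms(2) Suc.prems]])
  finally show ?case .
qed simp

lemma higher_deriv_scale:
  assumes "smooth_on UNIV f"
  shows "(deriv ^^ n) (\<lambda>y. f (c * y)) x = c ^ n * (deriv ^^ n) f (c * x)"
proof (induction n arbitrary: x)
  case (Suc n)
  have "((\<lambda>y. c ^ n * (deriv ^^ n) f (c * y)) has_real_derivative c ^ n * ((deriv ^^ Suc n) f (c * x) * c)) (at x)"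
    by (intro DERIV_cmult DERIV_chain2 [OF smooth_on_DERIV [OF assms]])
      (auto intro!: derivative_eq_intros)
  from DERIV_imp_deriv [OF this] show ?case
    by (simp add: ext [OF Suc.IH])
qed simp


section \<open>Wronskians\<close>

lemma wronskian_cong:
  assumes "open S" "x \<in> S" "list_all2 (\<lambda>f g. \<forall>y\<in>S. f y = g y) fs gs"
  shows "wronskian fs x = wronskian gs x"
proof -
  have len: "length fs = length gs"
    using assms(3) by (rule list_all2_lengthD)
  have "mat (length fs) (length fs) (\<lambda>(i, j). (deriv ^^ j) (fs ! i) x) =
      mat (length gs) (length gs) (\<lambda>(i, j). (deriv ^^ j) (gs ! i) x)"
  proof (rule eq_matI)
    fix i j assume ij: "i < dim_row (mat (length gs) (length gs) (\<lambda>(i, j). (deriv ^^ j) (gs ! i) x))"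
      "j < dim_col (mat (length gs) (length gs) (\<lambda>(i, j). (deriv ^^ j) (gs ! i) x))"
    then have "\<forall>y\<in>S. (fs ! i) y = (gs ! i) y"
      using list_all2_nthD [OF assms(3), of i] len by simp
    then have "(deriv ^^ j) (fs ! i) x = (deriv ^^ j) (gs ! i) x"
      using assms(1,2) by (intro higher_deriv_cong_on [of S]) auto
    with ij len show "mat (length fs) (length fs) (\<lambda>(i, j). (deriv ^^ j) (fs ! i) x) $$ (i, j) =
        mat (length gs) (length gs) (\<lambda>(i, j). (deriv ^^ j) (gs ! i) x) $$ (i, j)"
      by simp
  qed (use len in auto)
  then show ?thesis unfolding wronskian_def by simp
qed

text \<open>Each permutation picks one entry from every row and every column. The row factors serve
  constant multiples of the functions, the column factors the substitution
  \<open>c * x\<close>.\<close>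

lemma det_scale_rows:
  fixes a :: "nat \<Rightarrow> real"
  shows "det (mat n n (\<lambda>(i, j). c i * d j * A i j)) =
    (\<Prod>i<n. c i) * (\<Prod>j<n. d j) * det (mat n n (\<lambda>(i, j). A i j :: real))"
proof -
  have "(\<Prod>i = 0..<n. c i * d (p i) * A i (p i)) =
      ((\<Prod>i<n. c i) * (\<Prod>j<n. d j)) * (\<Prod>i = 0..<n. A i (p i))"
    if "p permutes {0..<n}" for p
    using prod.permute [OF that, of d] by (simp add: prod.distrib atLeast0LessThan o_def)
  moreover have "p i < n" if "p permutes {0..<n}" "i < n" for p i
    using permutes_in_image [OF that(1), of i] that(2) by simp
  ultimately show ?thesis
    by (subst (1 2) det_def' [of _ n]) (auto simp: sum_distrib_left intro!: sum.cong)
qed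

lemma wronskian_cmult:
  assumes "open S" "x \<in> S" "length fs = length gs" "length cs = length gs"
    and "\<And>i y. i < length gs \<Longrightarrow> y \<in> S \<Longrightarrow> (fs ! i) y = cs ! i * (gs ! i) y"
    and "\<And>g. g \<in> set gs \<Longrightarrow> smooth_on S g"
  shows "wronskian fs x = prod_list cs * wronskian gs x"
proof -
  let ?n = "length gs"
  have "(deriv ^^ j) (fs ! i) x = cs ! i * 1 * (deriv ^^ j) (gs ! i) x" if "i < ?n" for i j
    using higher_deriv_cong_on [OF assms(1) assms(5) [OF that] assms(2), where j = j]
      higher_deriv_cmult_on [OF assms(1) assms(6) [of "gs ! i"] assms(2), of j "cs ! i"] that
    by simp
  then have "mat ?n ?n (\<lambda>(i, j). (deriv ^^ j) (fs ! i) x) =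
      mat ?n ?n (\<lambda>(i, j). cs ! i * 1 * (deriv ^^ j) (gs ! i) x)"
    by (intro eq_matI) auto
  then show ?thesis
    using det_scale_rows [of ?n "\<lambda>i. cs ! i" "\<lambda>_. 1" "\<lambda>i j. (deriv ^^ j) (gs ! i) x"] assms(3,4)
    by (simp add: wronskian_def prod.list_conv_set_nth atLeast0LessThan)
qed

text \<open>Smoothness is required on the whole line because for negative \<open>c\<close> the
  arguments leave the half-line \<open>x > 0\<close>.\<close>

lemma wronskian_scale:
  assumes "\<And>f. f \<in> set fs \<Longrightarrow> smooth_on UNIV f"
  shows "wronskian (map (\<lambda>f y. f (c * y)) fs) x = (\<Prod>j<length fs. c ^ j) * wronskian fs (c * x)"
proof -
  let ?n = "length fs"
  have "mat ?n ?n (\<lambda>(i, j). (deriv ^^ j) (map (\<lambda>f y. f (c * y)) fs ! i) x) =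
      mat ?n ?n (\<lambda>(i, j). 1 * c ^ j * (deriv ^^ j) (fs ! i) (c * x))"
    using assms by (intro eq_matI) (auto simp: higher_deriv_scale)
  then show ?thesis
    using det_scale_rows [of ?n "\<lambda>_. 1" "\<lambda>j. c ^ j" "\<lambda>i j. (deriv ^^ j) (fs ! i) (c * x)"]
    by (simp add: wronskian_def)
qed

text \<open>The constant is the sign of a permutation, hence independent of \<open>x\<close>; from
  here on lists of functions need only be compared as multisets.\<close>

lemma wronskian_permute:
  assumes "mset fs = mset gs"
  obtains e :: real where "e \<noteq> 0" "\<And>x. wronskian fs x = e * wronskian gs x"
proof -
  obtain p where p: "p permutes {..<length gs}" "permute_list p gs = fs"
    using mset_eq_permutation [OF assms] .
  have p': "p permutes {0..<length gs}" using p(1) by (simp add: atLeast0LessThan)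
  have len: "length fs = length gs" using p(2) by (metis length_permute_list)
  have "wronskian fs x = signof p * wronskian gs x" for x
  proof -
    let ?A = "mat (length gs) (length gs) (\<lambda>(i, j). (deriv ^^ j) (gs ! i) x)"
    have "mat (length fs) (length fs) (\<lambda>(i, j). (deriv ^^ j) (fs ! i) x) =
        mat (length gs) (length gs) (\<lambda>(i, j). ?A $$ (p i, j))"
    proof (rule eq_matI)
      fix i j assume ij: "i < dim_row (mat (length gs) (length gs) (\<lambda>(i, j). ?A $$ (p i, j)))"
        "j < dim_col (mat (length gs) (length gs) (\<lambda>(i, j). ?A $$ (p i, j)))"
      then have "p i < length gs" using permutes_in_image [OF p(1), of i] by simp
      moreover have "fs ! i = gs ! p i"
        using p ij permute_list_nth [of p gs i] by auto
      ultimately show "mat (length fs) (length fs) (\<lambda>(i, j). (deriv ^^ j) (fs ! i) x) $$ (i, j) =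
          mat (length gs) (length gs) (\<lambda>(i, j). ?A $$ (p i, j)) $$ (i, j)"
        using ij len by simp
    qed (use len in auto)
    then show ?thesis
      unfolding wronskian_def using det_permute_rows [OF _ p', of ?A] by simp
  qed
  moreover have "signof p \<noteq> (0 :: real)" by (simp add: sign_def)
  ultimately show thesis using that by blast
qed

text \<open>The row of the constant is (1, 0, ..., 0), and in the one surviving minor the orders of
  differentiation start at one.\<close>

lemma wronskian_Cons_1: "wronskian ((\<lambda>x. 1) # fs) x = wronskian (map deriv fs) x"
proof -
  let ?n = "length fs"
  let ?A = "mat (Suc ?n) (Suc ?n) (\<lambda>(i, j). (deriv ^^ j) (((\<lambda>x. 1) # fs) ! i) x)"
  have d: "(deriv ^^ j) (\<lambda>x. 1 :: real) x = (if j = 0 then 1 else 0)" for j x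
  proof (cases j)
    case (Suc i)
    have "(deriv ^^ i) (\<lambda>x. 0 :: real) = (\<lambda>x. 0)"
      by (induction i) simp_all
    then show ?thesis by (simp add: Suc funpow_Suc_right del: funpow.simps)
  qed simp
  have "det ?A = (\<Sum>j<Suc ?n. ?A $$ (0, j) * cofactor ?A 0 j)"
    by (rule laplace_expansion_row [of _ "Suc ?n"]) auto
  also have "\<dots> = (\<Sum>j<Suc ?n. if j = 0 then cofactor ?A 0 j else 0)"
    by (rule sum.cong) (auto simp: d)
  also have "\<dots> = cofactor ?A 0 0"
    by (subst sum.delta) auto
  also have "mat_delete ?A 0 0 =
      mat (length (map deriv fs)) (length (map deriv fs)) (\<lambda>(i, j). (deriv ^^ j) (map deriv fs ! i) x)"
    by (rule eq_matI) (auto simp: mat_delete_def funpow_Suc_right simp del: funpow.simps)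
  then have "cofactor ?A 0 0 = wronskian (map deriv fs) x"
    by (simp add: cofactor_def wronskian_def)
  finally show ?thesis by (simp add: wronskian_def)
qed

text \<open>By the Leibniz rule, multiplying every function by \<open>h\<close> multiplies the
  Wronskian matrix from the right by an upper triangular matrix with \<open>h x\<close> on the
  diagonal.\<close>

lemma wronskian_mult:
  assumes "open S" "x \<in> S" "smooth_on S h" "\<And>f. f \<in> set fs \<Longrightarrow> smooth_on S f"
  shows "wronskian (map (\<lambda>f y. h y * f y) fs) x = h x ^ length fs * wronskian fs x"
proof -
  let ?n = "length fs"
  let ?W = "mat ?n ?n (\<lambda>(i, j). (deriv ^^ j) (fs ! i) x)"
  let ?U = "mat ?n ?n (\<lambda>(k, j). if k \<le> j then real (j choose k) * (deriv ^^ (j - k)) h x else 0)"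
  have "mat ?n ?n (\<lambda>(i, j). (deriv ^^ j) (map (\<lambda>f y. h y * f y) fs ! i) x) = ?W * ?U"
  proof (rule eq_matI)
    fix i j assume "i < dim_row (?W * ?U)" "j < dim_col (?W * ?U)"
    then have ij: "i < ?n" "j < ?n" by auto
    have "(deriv ^^ j) (\<lambda>y. h y * (fs ! i) y) x = (deriv ^^ j) (\<lambda>y. (fs ! i) y * h y) x"
      by (simp add: mult.commute)
    also have "\<dots> = (\<Sum>k\<le>j. real (j choose k) * (deriv ^^ k) (fs ! i) x * (deriv ^^ (j - k)) h x)"
      using assms ij by (intro higher_deriv_mult_on [of S]) auto
    also have "\<dots> = (\<Sum>k\<in>{0..<?n}. (deriv ^^ k) (fs ! i) x *
        (if k \<le> j then real (j choose k) * (deriv ^^ (j - k)) h x else 0))"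
      using ij by (intro sum.mono_neutral_cong_left) auto
    also have "\<dots> = (?W * ?U) $$ (i, j)"
      using ij by (simp add: scalar_prod_def)
    finally show "mat ?n ?n (\<lambda>(i, j). (deriv ^^ j) (map (\<lambda>f y. h y * f y) fs ! i) x) $$ (i, j) =
        (?W * ?U) $$ (i, j)"
      using ij by simp
  qed auto
  moreover have "det ?U = h x ^ ?n"
  proof -
    have "det ?U = prod_list (diag_mat ?U)"
      by (rule det_upper_triangular [of _ ?n]) (auto simp: upper_triangular_def)
    also have "diag_mat ?U = replicate ?n (h x)"
      by (auto simp: diag_mat_def map_replicate_const intro!: nth_equalityI)
    finally show ?thesis by simp
  qed
  ultimately show ?thesis
    by (simp add: wronskian_def det_mult [of _ ?n])
qed


lemma wronskian_proportional:
  assumes "open S" and rel: "list_all2 (\<lambda>f g. \<exists>c. c \<noteq> 0 \<and> (\<forall>y\<in>S. f y = c * g y)) fs gs"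
    and "\<And>g. g \<in> set gs \<Longrightarrow> smooth_on S g"
  obtains C where "C \<noteq> 0" "\<And>x. x \<in> S \<Longrightarrow> wronskian fs x = C * wronskian gs x"
proof -
  have len: "length fs = length gs" using rel by (rule list_all2_lengthD)
  have "\<exists>c. \<forall>i. i < length gs \<longrightarrow> c i \<noteq> 0 \<and> (\<forall>y\<in>S. (fs ! i) y = c i * (gs ! i) y)"
    using list_all2_nthD [OF rel] len by (intro choice) auto
  then obtain c where c: "\<And>i. i < length gs \<Longrightarrow> c i \<noteq> 0 \<and> (\<forall>y\<in>S. (fs ! i) y = c i * (gs ! i) y)"
    by auto
  define cs where "cs = map c [0..<length gs]"
  have "wronskian fs x = prod_list cs * wronskian gs x" if "x \<in> S" for x
    using assms(1,3) len c that by (intro wronskian_cmult [of S]) (auto simp: cs_def)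
  moreover have "prod_list cs \<noteq> 0"
    using c by (auto simp: cs_def prod_list_zero_iff)
  ultimately show thesis using that by blast
qed


section \<open>Laguerre polynomials\<close>

lemma laguerre_0 [simp]: "laguerre a 0 x = 1"
  by (simp add: laguerre_def)

lemma laguerre_DERIV_0: "(laguerre a 0 has_real_derivative 0) (at x)"
  by (simp add: ext [of "laguerre a 0" "\<lambda>x. 1"])

lemma laguerre_DERIV_Suc:
  "(laguerre a (Suc n) has_real_derivative - laguerre (a + 1) n x) (at x)"
proof -
  have "(\<Sum>k\<le>Suc n. c k * (real k * (- x) ^ (k - 1) * (- 1)) / fact k) =
      - (\<Sum>k\<le>n. c (Suc k) * (- x) ^ k / fact k)" for c :: "nat \<Rightarrow> real"
  proof -
    have "(\<Sum>k\<le>Suc n. c k * (real k * (- x) ^ (k - 1) * (- 1)) / fact k) =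
        (\<Sum>k\<le>n. c (Suc k) * (real (Suc k) * (- x) ^ k * (- 1)) / fact (Suc k))"
      by (subst sum.atMost_Suc_shift) simp
    also have "\<dots> = (\<Sum>k\<le>n. - (c (Suc k) * (- x) ^ k / fact k))"
      by (rule sum.cong) (simp_all add: divide_simps del: of_nat_Suc)
    finally show ?thesis by (simp add: sum_negf)
  qed
  note * = this [of "\<lambda>k. (real (Suc n) + a) gchoose (Suc n - k)"]
  have "(laguerre a (Suc n) has_real_derivative
      (\<Sum>k\<le>Suc n. ((real (Suc n) + a) gchoose (Suc n - k)) * (real k * (- x) ^ (k - 1) * (- 1)) / fact k)) (at x)"
    unfolding laguerre_def [abs_def]
    by (intro DERIV_sum) (auto intro!: derivative_eq_intros)
  then show ?thesis
    unfolding * by (simp add: laguerre_def add.commute add.left_commute)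
qed

lemma laguerre_Suc_add: "laguerre a (Suc n) x + laguerre (a + 1) n x = laguerre (a + 1) (Suc n) x"
proof -
  have "((real (Suc n) + a) gchoose (Suc n - k)) + ((real n + (a + 1)) gchoose (n - k)) =
      (real (Suc n) + (a + 1)) gchoose (Suc n - k)" if "k \<le> n" for k
    using that gbinomial_Suc_Suc [of "real n + a + 1" "n - k"]
    by (simp add: Suc_diff_le add.commute add.left_commute)
  note pascal = this
  have "(\<Sum>k\<le>n. ((real (Suc n) + a) gchoose (Suc n - k)) * (- x) ^ k / fact k) +
      (\<Sum>k\<le>n. ((real n + (a + 1)) gchoose (n - k)) * (- x) ^ k / fact k) =
      (\<Sum>k\<le>n. ((real (Suc n) + (a + 1)) gchoose (Suc n - k)) * (- x) ^ k / fact k)"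
    unfolding sum.distrib [symmetric]
  proof (rule sum.cong)
    fix k assume "k \<in> {..n}"
    then show "((real (Suc n) + a) gchoose (Suc n - k)) * (- x) ^ k / fact k +
        ((real n + (a + 1)) gchoose (n - k)) * (- x) ^ k / fact k =
        ((real (Suc n) + (a + 1)) gchoose (Suc n - k)) * (- x) ^ k / fact k"
      using pascal [of k] by (simp only: add_divide_distrib [symmetric] distrib_right [symmetric] atMost_iff)
  qed simp
  then show ?thesis
    by (simp add: laguerre_def)
qed

text \<open>These are the derivative formulas for e^(-x) L and x^a L with the extra factors
  cancelled. Keeping \<open>D\<close> implicit treats n = 0 and n > 0 alike, although the closed
  form of the derivative differs.\<close>

lemma laguerre_DERIV:
  obtains D where "(laguerre a n has_real_derivative D) (at x)"
    and "laguerre a n x - D = laguerre (a + 1) n x"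
    and "a * laguerre a n x + x * D = (real n + a) * laguerre (a - 1) n x"
proof -
  define D where "D = (\<Sum>k\<le>n. ((real n + a) gchoose (n - k)) * (real k * (- x) ^ (k - 1) * (- 1)) / fact k)"
  have D: "(laguerre a n has_real_derivative D) (at x)"
    unfolding laguerre_def [abs_def] D_def
    by (intro DERIV_sum) (auto intro!: derivative_eq_intros)
  have 1: "laguerre a n x - D = laguerre (a + 1) n x"
  proof (cases n)
    case 0
    then show ?thesis using DERIV_unique [OF D] laguerre_DERIV_0 [of a x] by simp
  next
    case (Suc m)
    then have "D = - laguerre (a + 1) m x" using DERIV_unique [OF D] laguerre_DERIV_Suc by blast
    with Suc laguerre_Suc_add show ?thesis by simp
  qed
  have "a * laguerre a n x + x * D = (\<Sum>k\<le>n. (a + real k) * ((real n + a) gchoose (n - k)) * (- x) ^ k / fact k)"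
    unfolding laguerre_def D_def sum_distrib_left sum.distrib [symmetric]
  proof (rule sum.cong)
    fix k
    have *: "x * (real k * (- x) ^ (k - 1) * (- 1)) = real k * (- x) ^ k"
      by (cases k) simp_all
    have "a * (c * (- x) ^ k / fact k) + x * (c * (real k * (- x) ^ (k - 1) * (- 1)) / fact k) =
        a * (c * (- x) ^ k / fact k) + c * (x * (real k * (- x) ^ (k - 1) * (- 1))) / fact k" for c
      by simp
    also have "\<dots> c = (a + real k) * c * (- x) ^ k / fact k" for c
      unfolding * by (simp add: algebra_simps add_divide_distrib)
    finally show "a * (((real n + a) gchoose (n - k)) * (- x) ^ k / fact k) +
        x * (((real n + a) gchoose (n - k)) * (real k * (- x) ^ (k - 1) * (- 1)) / fact k) =
        (a + real k) * ((real n + a) gchoose (n - k)) * (- x) ^ k / fact k" .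
  qed simp
  also have "\<dots> = (\<Sum>k\<le>n. (real n + a) * (((real n + (a - 1)) gchoose (n - k)) * (- x) ^ k / fact k))"
  proof (rule sum.cong)
    \<comment> \<open>Binomial absorption, since a + k = (n + a) - (n - k).\<close>
    fix k assume "k \<in> {..n}"
    then have "(a + real k) * ((real n + a) gchoose (n - k)) =
        (real n + a) * ((real n + a - 1) gchoose (n - k))"
      using gbinomial_absorb_comp [of "real n + a" "n - k"] by (simp add: of_nat_diff)
    then show "(a + real k) * ((real n + a) gchoose (n - k)) * (- x) ^ k / fact k =
        (real n + a) * (((real n + (a - 1)) gchoose (n - k)) * (- x) ^ k / fact k)"
      by (simp add: algebra_simps)
  qed simp
  also have "\<dots> = (real n + a) * laguerre (a - 1) n x"
    by (simp add: laguerre_def sum_distrib_left)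
  finally show thesis using that D 1 by blast
qed

text \<open>Both formulas for the derivative of L_(n+1)^(a-1), by \<open>laguerre_DERIV_Suc\<close>
  and by \<open>laguerre_DERIV\<close>, are compared and the parameter a - 2 is removed by
  \<open>laguerre_Suc_add\<close>.\<close>

lemma laguerre_Suc_eq:
  "(real n + a) * laguerre (a - 1) n x - x * laguerre a n x = (real n + 1) * laguerre (a - 1) (Suc n) x"
proof -
  obtain D where "(laguerre (a - 1) (Suc n) has_real_derivative D) (at x)"
    and D: "(a - 1) * laguerre (a - 1) (Suc n) x + x * D =
      (real (Suc n) + (a - 1)) * laguerre (a - 1 - 1) (Suc n) x"
    by (rule laguerre_DERIV)
  then have "D = - laguerre a n x"
    using DERIV_unique laguerre_DERIV_Suc [of "a - 1" n x] by fastforce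
  moreover have L: "laguerre (a - 1 - 1) (Suc n) x = laguerre (a - 1) (Suc n) x - laguerre (a - 1) n x"
    using laguerre_Suc_add [of "a - 1 - 1" n x] by simp
  ultimately have "(a - 1) * laguerre (a - 1) (Suc n) x - x * laguerre a n x =
      (real n + a) * (laguerre (a - 1) (Suc n) x - laguerre (a - 1) n x)"
    using D unfolding L by simp
  then show ?thesis by (simp add: algebra_simps)
qed

text \<open>The exponential turns the derivative into the combination L - D of
  \<open>laguerre_DERIV\<close>, so the parameter rises while the degree stays.\<close>

lemma seed2_DERIV:
  "((\<lambda>x. exp (e * x) * laguerre a n (- (e * x))) has_real_derivative
    e * (exp (e * x) * laguerre (a + 1) n (- (e * x)))) (at x)"
proof -
  obtain D where D: "(laguerre a n has_real_derivative D) (at (- (e * x)))"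
    and *: "laguerre (a + 1) n (- (e * x)) = laguerre a n (- (e * x)) - D"
    using laguerre_DERIV [of a n "- (e * x)"] by metis
  have "((\<lambda>x. laguerre a n (- (e * x))) has_real_derivative D * (- e)) (at x)"
    by (rule DERIV_chain2 [where g = "\<lambda>x. - (e * x)", OF D]) (auto intro!: derivative_eq_intros)
  then show ?thesis
    unfolding * by (auto intro!: derivative_eq_intros simp: algebra_simps)
qed

lemma seed3_DERIV:
  assumes "x > 0"
  shows "((\<lambda>x. x powr (- a) * laguerre (- a) n (e * x)) has_real_derivative
    (real n - a) * (x powr (- (a + 1)) * laguerre (- (a + 1)) n (e * x))) (at x)"
proof -
  obtain D where D: "(laguerre (- a) n has_real_derivative D) (at (e * x))"
    and *: "- a * laguerre (- a) n (e * x) + e * x * D = (real n + - a) * laguerre (- a - 1) n (e * x)"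
    using laguerre_DERIV [of "- a" n "e * x"] by (metis (no_types, lifting) mult.assoc)
  have L: "((\<lambda>x. laguerre (- a) n (e * x)) has_real_derivative D * e) (at x)"
    by (rule DERIV_chain2 [where g = "\<lambda>x. e * x", OF D]) (auto intro!: derivative_eq_intros)
  have x: "x powr (- a) = x powr (- a - 1) * x"
    using assms by (simp add: powr_diff)
  have "((\<lambda>x. x powr (- a) * laguerre (- a) n (e * x)) has_real_derivative
      - a * x powr (- a - 1) * laguerre (- a) n (e * x) + D * e * x powr (- a)) (at x)"
    by (rule DERIV_mult [OF has_real_derivative_powr [OF assms] L])
  also have "- a * x powr (- a - 1) * laguerre (- a) n (e * x) + D * e * x powr (- a) =
      x powr (- a - 1) * (- a * laguerre (- a) n (e * x) + e * x * D)"
    unfolding x by (simp add: algebra_simps)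
  finally show ?thesis unfolding * by (simp add: mult_ac)
qed

text \<open>Multiplying the third type by an exponential leaves a stray multiple of
  \<open>x\<close>, which \<open>laguerre_Suc_eq\<close> absorbs by raising the degree. The constant
  n + 1 never vanishes, unlike the n - a of \<open>seed3_DERIV\<close>.\<close>

lemma seed4_DERIV:
  assumes "x > 0"
  shows "((\<lambda>x. exp (e * x) * x powr (- a) * laguerre (- a) n (- (e * x))) has_real_derivative
    (real n + 1) * (exp (e * x) * x powr (- (a + 1)) * laguerre (- (a + 1)) (Suc n) (- (e * x)))) (at x)"
proof -
  have "((\<lambda>x. exp (e * x) * (x powr (- a) * laguerre (- a) n (- e * x))) has_real_derivative
    e * exp (e * x) * (x powr (- a) * laguerre (- a) n (- e * x)) +
    (real n - a) * (x powr (- (a + 1)) * laguerre (- (a + 1)) n (- e * x)) * exp (e * x)) (at x)"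
    by (rule DERIV_mult [OF _ seed3_DERIV [OF assms]]) (auto intro!: derivative_eq_intros)
  moreover have "x powr (- a) = x powr (- (a + 1)) * x"
    using assms by (simp add: powr_diff powr_minus)
  moreover have "e * exp (e * x) * (x powr (- (a + 1)) * x * laguerre (- a) n (- e * x)) +
    (real n - a) * (x powr (- (a + 1)) * laguerre (- (a + 1)) n (- e * x)) * exp (e * x) =
    exp (e * x) * x powr (- (a + 1)) *
      ((real n + - a) * laguerre (- (a + 1)) n (- e * x) - (- e * x) * laguerre (- a) n (- e * x))"
    by (simp add: algebra_simps)
  moreover have "(real n + - a) * laguerre (- (a + 1)) n (- e * x) - (- e * x) * laguerre (- a) n (- e * x) =
      (real n + 1) * laguerre (- (a + 1)) (Suc n) (- e * x)"
    using laguerre_Suc_eq [of n "- a" "- e * x"] by simp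
  ultimately show ?thesis
    by (simp only: mult.assoc mult.left_commute mult_minus_left)
qed

text \<open>The sign \<open>e = \<plusminus>1\<close> stands for the substitution \<open>x \<mapsto> -x\<close>, which is not available directly
  because the powers of \<open>x\<close> are restricted to \<open>x > 0\<close>.\<close>

definition seeds :: "real \<Rightarrow> real \<Rightarrow> nat list \<Rightarrow> nat list \<Rightarrow> nat list \<Rightarrow> nat list \<Rightarrow> (real \<Rightarrow> real) list" where
  "seeds e a ns ms ms' ns' =
    map (\<lambda>n x. laguerre a n (e * x)) ns @
    map (\<lambda>m x. exp (e * x) * laguerre a m (- (e * x))) ms @
    map (\<lambda>m x. x powr (- a) * laguerre (- a) m (e * x)) ms' @
    map (\<lambda>n x. exp (e * x) * x powr (- a) * laguerre (- a) n (- (e * x))) ns'"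

lemma length_seeds [simp]:
  "length (seeds e a ns ms ms' ns') = length ns + length ms + length ms' + length ns'"
  by (simp add: seeds_def)

text \<open>Continuity in the parameter \<open>a\<close> does not by itself pass to derivatives in
  \<open>x\<close>. This class of functions of both variables is closed under differentiation in
  \<open>x\<close> and continuous in \<open>a\<close>, so every entry of a seed Wronskian depends
  continuously on \<open>a\<close>.\<close>

inductive exp_powr_family :: "(real \<Rightarrow> real \<Rightarrow> real) \<Rightarrow> bool" where
  base: "continuous_on UNIV c \<Longrightarrow> exp_powr_family (\<lambda>a x. c a * exp (g * x) * x powr (b + k * a))"
| add: "exp_powr_family f \<Longrightarrow> exp_powr_family h \<Longrightarrow> exp_powr_family (\<lambda>a x. f a x + h a x)"

lemma exp_powr_family_sum:
  assumes "finite A" "\<And>i. i \<in> A \<Longrightarrow> exp_powr_family (f i)"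
  shows "exp_powr_family (\<lambda>a x. \<Sum>i\<in>A. f i a x)"
  using assms
proof (induction A rule: finite_induct)
  case empty
  show ?case using exp_powr_family.base [of "\<lambda>_. 0" 0 0 0] by simp
next
  case (insert i A)
  then show ?case using exp_powr_family.add [of "f i" "\<lambda>a x. \<Sum>i\<in>A. f i a x"] by simp
qed

lemma exp_powr_family_continuous:
  assumes "exp_powr_family f" "x > 0"
  shows "continuous_on UNIV (\<lambda>a. f a x)"
  using assms by induction (auto intro!: continuous_intros)

lemma exp_powr_family_deriv:
  assumes "exp_powr_family f"
  shows "\<exists>h. exp_powr_family h \<and> (\<forall>a. \<forall>x>0. (f a has_real_derivative h a x) (at x))"
  using assms
proof induction
  case (base c g b k)
  let ?h = "\<lambda>a x. (g * c a) * exp (g * x) * x powr (b + k * a) +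
      (c a * (b + k * a)) * exp (g * x) * x powr ((b - 1) + k * a)"
  have "exp_powr_family ?h"
    using base by (intro exp_powr_family.intros continuous_intros)
  moreover have "((\<lambda>x. c a * exp (g * x) * x powr (b + k * a)) has_real_derivative ?h a x) (at x)"
    if "x > 0" for a x
  proof -
    have "((\<lambda>x. c a * exp (g * x)) has_real_derivative g * c a * exp (g * x)) (at x)"
      by (auto intro!: derivative_eq_intros)
    from DERIV_mult [OF this has_real_derivative_powr [OF that, of "b + k * a"]]
    show ?thesis by (simp add: algebra_simps)
  qed
  ultimately show ?case by blast
next
  case (add f h)
  then obtain f' h' where "exp_powr_family f'" "exp_powr_family h'"
    "\<And>a x. x > 0 \<Longrightarrow> (f a has_real_derivative f' a x) (at x)"
    "\<And>a x. x > 0 \<Longrightarrow> (h a has_real_derivative h' a x) (at x)"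
    by blast
  then show ?case
    by (intro exI [of _ "\<lambda>a x. f' a x + h' a x"]) (auto intro!: exp_powr_family.add DERIV_add)
qed

lemma exp_powr_family_higher_deriv:
  assumes "exp_powr_family f"
  shows "\<exists>h. exp_powr_family h \<and> (\<forall>a. \<forall>x>0. (deriv ^^ j) (f a) x = h a x)"
proof (induction j)
  case 0
  then show ?case using assms by auto
next
  case (Suc j)
  then obtain g where g: "exp_powr_family g" "\<And>a x. x > 0 \<Longrightarrow> (deriv ^^ j) (f a) x = g a x"
    by blast
  obtain h where h: "exp_powr_family h" "\<And>a x. x > 0 \<Longrightarrow> (g a has_real_derivative h a x) (at x)"
    using exp_powr_family_deriv [OF g(1)] by blast
  have "(deriv ^^ Suc j) (f a) x = h a x" if "x > 0" for a x
    using higher_deriv_cong_on [of "{0<..}" "(deriv ^^ j) (f a)" "g a" x 1] g(2) that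
      DERIV_imp_deriv [OF h(2) [OF that]] by simp
  with h(1) show ?case by auto
qed

lemma exp_powr_family_smooth:
  assumes "exp_powr_family f"
  shows "smooth_on {0<..} (f a)"
proof (rule smooth_on_closed_class [where P = "\<lambda>g. \<exists>h. exp_powr_family h \<and> g = h a"])
  fix g assume "\<exists>h. exp_powr_family h \<and> g = h a"
  then show "\<exists>h. (\<exists>k. exp_powr_family k \<and> h = k a) \<and> (\<forall>x\<in>{0<..}. (g has_real_derivative h x) (at x))"
    by (metis exp_powr_family_deriv greaterThan_iff)
qed (use assms in auto)

lemma continuous_on_gbinomial [continuous_intros]:
  fixes f :: "real \<Rightarrow> real"
  assumes "continuous_on A f"
  shows "continuous_on A (\<lambda>a. f a gchoose n)"
  unfolding gbinomial_prod_rev using assms by (auto intro!: continuous_intros)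

text \<open>\<open>g\<close>, \<open>k\<close> and \<open>l\<close> select the type of seed.
  Equality is claimed for \<open>x > 0\<close> only, where natural powers merge with the real power
  \<open>k * a\<close>.\<close>

lemma exp_powr_family_laguerre:
  "\<exists>f. exp_powr_family f \<and>
    (\<forall>a. \<forall>x>0. exp (g * x) * x powr (k * a) * laguerre (l * a) n (d * x) = f a x)"
proof (intro exI conjI allI impI)
  let ?c = "\<lambda>i a. ((real n + l * a) gchoose (n - i)) * (- d) ^ i / fact i"
  let ?f = "\<lambda>a x. \<Sum>i\<le>n. ?c i a * exp (g * x) * x powr (real i + k * a)"
  show "exp_powr_family ?f"
    by (intro exp_powr_family_sum exp_powr_family.base continuous_intros) auto
  fix a x :: real assume "x > 0"
  then show "exp (g * x) * x powr (k * a) * laguerre (l * a) n (d * x) = ?f a x"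
    unfolding laguerre_def sum_distrib_left
    by (intro sum.cong) (auto simp: powr_add powr_realpow power_mult_distrib power_minus' mult_ac)
qed

lemma seeds_family:
  assumes "i < length ns + length ms + length ms' + length ns'"
  shows "\<exists>f. exp_powr_family f \<and> (\<forall>a. \<forall>x>0. (seeds e a ns ms ms' ns' ! i) x = f a x)"
proof -
  note F = exp_powr_family_laguerre
  consider "i < length ns" | j where "i = length ns + j" "j < length ms"
    | j where "i = length ns + length ms + j" "j < length ms'"
    | j where "i = length ns + length ms + length ms' + j" "j < length ns'"
    using assms by (metis add.assoc add_diff_inverse_nat nat_add_left_cancel_less)
  then show ?thesis
  proof cases
    case 1
    then show ?thesis using F [of 0 0 1 "ns ! i" e] by (simp add: seeds_def nth_append)
  next
    case 2
    then show ?thesis using F [of e 0 1 "ms ! j" "- e"] by (simp add: seeds_def nth_append)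
  next
    case 3
    then show ?thesis using F [of 0 "- 1" "- 1" "ms' ! j" e] by (simp add: seeds_def nth_append)
  next
    case 4
    then show ?thesis using F [of e "- 1" "- 1" "ns' ! j" "- e"] by (simp add: seeds_def nth_append)
  qed
qed

lemma smooth_on_seeds:
  assumes "f \<in> set (seeds e a ns ms ms' ns')"
  shows "smooth_on {0<..} f"
proof -
  obtain i where i: "i < length (seeds e a ns ms ms' ns')" "f = seeds e a ns ms ms' ns' ! i"
    using assms by (metis in_set_conv_nth)
  then obtain h where "exp_powr_family h" "\<And>x. x > 0 \<Longrightarrow> f x = h a x"
    using seeds_family [of i ns ms ms' ns' e] unfolding length_seeds by blast
  then show ?thesis
    by (intro smooth_on_cong [OF _ _ exp_powr_family_smooth]) auto
qed

lemma continuous_on_wronskian_seeds: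
  assumes "x > 0"
  shows "continuous_on UNIV (\<lambda>a. wronskian (seeds e a ns ms ms' ns') x)"
proof -
  define n where "n = length ns + length ms + length ms' + length ns'"
  have c: "continuous_on UNIV (\<lambda>a. (deriv ^^ j) (seeds e a ns ms ms' ns' ! i) x)" if i: "i < n" for i j
  proof -
    obtain f where f: "exp_powr_family f" "\<And>a x. x > 0 \<Longrightarrow> (seeds e a ns ms ms' ns' ! i) x = f a x"
      using seeds_family [OF i [unfolded n_def], of e] by blast
    obtain h where h: "exp_powr_family h" "\<And>a x. x > 0 \<Longrightarrow> (deriv ^^ j) (f a) x = h a x"
      using exp_powr_family_higher_deriv [OF f(1)] by blast
    have "(deriv ^^ j) (seeds e a ns ms ms' ns' ! i) x = h a x" for a
      using higher_deriv_cong_on [of "{0<..}" "seeds e a ns ms ms' ns' ! i" "f a" x j] f(2) h(2) assms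
      by simp
    then show ?thesis using exp_powr_family_continuous [OF h(1) assms] by simp
  qed
  have p: "p i < n" if "p permutes {0..<n}" "i < n" for p i
    using permutes_in_image [OF that(1), of i] that(2) by simp
  show ?thesis
    unfolding wronskian_def
    by (subst det_def' [of _ n]) (auto simp: n_def [symmetric] p intro!: continuous_intros c)
qed


section \<open>Elementary steps between seed Wronskians\<close>

text \<open>A nonzero constant makes the relation symmetric, so that elementary steps can be run
  backwards.\<close>

definition proportional :: "(real \<Rightarrow> real) \<Rightarrow> (real \<Rightarrow> real) \<Rightarrow> bool" where
  "proportional f g \<longleftrightarrow> (\<exists>C. C \<noteq> 0 \<and> (\<forall>x>0. f x = C * g x))"

lemma proportionalI: "C \<noteq> 0 \<Longrightarrow> (\<And>x. x > 0 \<Longrightarrow> f x = C * g x) \<Longrightarrow> proportional f g"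
  by (auto simp: proportional_def)

lemma proportional_refl: "proportional f f"
  by (rule proportionalI [of 1]) auto

lemma proportional_sym: "proportional f g \<Longrightarrow> proportional g f"
  unfolding proportional_def by (metis field_class.field_inverse inverse_nonzero_iff_nonzero mult.assoc mult_1)

lemma proportional_trans [trans]: "proportional f g \<Longrightarrow> proportional g h \<Longrightarrow> proportional f h"
  unfolding proportional_def by (metis mult.assoc no_zero_divisors)

definition normalized_wronskian :: "real \<Rightarrow> real \<Rightarrow> nat list \<Rightarrow> nat list \<Rightarrow> nat list \<Rightarrow> nat list \<Rightarrow> real \<Rightarrow> real" where
  "normalized_wronskian e a ns ms ms' ns' x =
    exp (- (e * (real (length ms) + real (length ns')) * x)) *
    x powr ((a + real (length ns) + real (length ms)) * (real (length ms') + real (length ns'))) *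
    wronskian (seeds e a ns ms ms' ns') x"

lemma normalized_wronskian_permute:
  assumes "mset ns = mset ps" "mset ms = mset qs" "mset ms' = mset qs'" "mset ns' = mset ps'"
  shows "proportional (normalized_wronskian e a ns ms ms' ns') (normalized_wronskian e a ps qs qs' ps')"
proof -
  have "mset (seeds e a ns ms ms' ns') = mset (seeds e a ps qs qs' ps')"
    using assms by (simp add: seeds_def)
  from wronskian_permute [OF this] obtain c where
    c: "c \<noteq> 0" "\<And>x. wronskian (seeds e a ns ms ms' ns') x = c * wronskian (seeds e a ps qs qs' ps') x"
    by blast
  have "length ns = length ps" "length ms = length qs" "length ms' = length qs'" "length ns' = length ps'"
    using assms by (auto dest: mset_eq_length)
  then show ?thesis
    using c by (intro proportionalI [of c]) (simp_all add: normalized_wronskian_def)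
qed

lemma smooth_on_exp: "smooth_on {0<..} (\<lambda>x. exp (c * x))"
  by (rule smooth_on_cong [OF _ _ exp_powr_family_smooth [OF exp_powr_family.base [of "\<lambda>_. 1" c 0 0]]])
    auto

lemma smooth_on_powr: "smooth_on {0<..} (\<lambda>x. x powr b)"
  by (rule smooth_on_cong [OF _ _ exp_powr_family_smooth [OF exp_powr_family.base [of "\<lambda>_. 1" 0 b 0]]])
    auto

text \<open>Dividing all seeds by \<open>exp (e * x)\<close> exchanges the types with and without
  exponential and flips the sign of the argument; the two diagrams trade places.\<close>

lemma normalized_wronskian_swap: "proportional (normalized_wronskian e a ns ms ms' ns') (normalized_wronskian (- e) a ms ns ns' ms')"
proof -
  let ?gs = "seeds (- e) a ms ns ns' ms'"
  have "exp (e * y) * (exp (- (e * y)) * z) = z" for y z :: real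
    by (simp add: exp_minus)
  then have "mset (seeds e a ns ms ms' ns') = mset (map (\<lambda>f y. exp (e * y) * f y) ?gs)"
    by (simp only: seeds_def map_append map_map o_def mset_append mult.assoc minus_minus
        mult_minus_left union_ac)
  from wronskian_permute [OF this] obtain c where
    c: "c \<noteq> 0" "\<And>x. wronskian (seeds e a ns ms ms' ns') x =
      c * wronskian (map (\<lambda>f y. exp (e * y) * f y) ?gs) x"
    by blast
  show ?thesis
  proof (rule proportionalI [OF c(1)])
    fix x :: real assume x: "x > 0"
    have "wronskian (map (\<lambda>f y. exp (e * y) * f y) ?gs) x = exp (e * x) ^ length ?gs * wronskian ?gs x"
      by (rule wronskian_mult [of "{0<..}"]) (use x in \<open>auto intro: smooth_on_exp smooth_on_seeds\<close>)
    \<comment> \<open>Exponent count, with r_i seeds of type i: -(r2 + r4) + (r1 + r2 + r3 + r4) =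
      r1 + r3.\<close>
    moreover have "exp (- (e * (real (length ms) + real (length ns')) * x)) * exp (e * x) ^ length ?gs =
        exp (- (- e * (real (length ns) + real (length ms')) * x))"
      by (simp add: exp_of_nat_mult [symmetric] algebra_simps flip: exp_add)
    ultimately show "normalized_wronskian e a ns ms ms' ns' x = c * normalized_wronskian (- e) a ms ns ns' ms' x"
      unfolding normalized_wronskian_def c(2) by (simp add: ac_simps)
  qed
qed

text \<open>Dividing all seeds by x^(-a) exchanges the types with and without power. On diagrams
  this trades places and also swaps elements with holes, so both diagrams are conjugated.\<close>

lemma normalized_wronskian_neg: "proportional (normalized_wronskian e a ns ms ms' ns') (normalized_wronskian e (- a) ms' ns' ns ms)"
proof -
  let ?gs = "seeds e (- a) ms' ns' ns ms"
  let ?hs = "map (\<lambda>f y. y powr (- a) * f y) (seeds e (- a) ms' ns' ns ms)"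
  \<comment> \<open>The cancelling powers are left in place, so that \<open>?ks\<close> and
    \<open>?hs\<close> are the same multiset of functions; the cancellation itself is valid for
    positive arguments only.\<close>
  let ?ks = "map (\<lambda>n y. y powr (- a) * (y powr a * laguerre a n (e * y))) ns @
    map (\<lambda>m y. y powr (- a) * (exp (e * y) * y powr a * laguerre a m (- (e * y)))) ms @
    map (\<lambda>m y. y powr (- a) * laguerre (- a) m (e * y)) ms' @
    map (\<lambda>n y. y powr (- a) * (exp (e * y) * laguerre (- a) n (- (e * y)))) ns'"
  have "mset ?ks = mset ?hs"
    by (simp add: seeds_def o_def)
  from wronskian_permute [OF this] obtain c where
    c: "c \<noteq> 0" "\<And>x. wronskian ?ks x = c * wronskian ?hs x"
    by blast
  have inv: "z = y powr (- a) * (y powr a * z)" if "y > 0" for y z :: real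
    using that by (simp add: powr_minus)
  have ks: "wronskian (seeds e a ns ms ms' ns') x = wronskian ?ks x" if "x > 0" for x
    unfolding seeds_def
  proof (rule wronskian_cong [of "{0<..}"]; (intro list_all2_appendI)?; (unfold list.rel_map)?;
      (intro list.rel_refl_strong)?)
    show "\<forall>y\<in>{0<..}. exp (e * y) * laguerre a m (- (e * y)) =
        y powr - a * (exp (e * y) * y powr a * laguerre a m (- (e * y)))" for m
      using inv by (simp add: mult.left_commute [of "exp _"])
  qed (use that inv in \<open>auto simp: mult.assoc\<close>)
  show ?thesis
  proof (rule proportionalI [OF c(1)])
    fix x :: real assume x: "x > 0"
    have "wronskian ?hs x = (x powr (- a)) ^ length ?gs * wronskian ?gs x"
      by (rule wronskian_mult [of "{0<..}"]) (use x in \<open>auto intro: smooth_on_powr smooth_on_seeds\<close>)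
    \<comment> \<open>With p = r1 + r2 and q = r3 + r4 this is (a + p) q - a (p + q) = (-a + q)
      p.\<close>
    moreover have "x powr ((a + real (length ns) + real (length ms)) * (real (length ms') + real (length ns'))) *
        (x powr (- a)) ^ length ?gs =
        x powr ((- a + real (length ms') + real (length ns')) * (real (length ns) + real (length ms)))"
      using x by (simp add: algebra_simps powr_powr flip: powr_add powr_realpow)
    ultimately show "normalized_wronskian e a ns ms ms' ns' x = c * normalized_wronskian e (- a) ms' ns' ns ms x"
      unfolding normalized_wronskian_def ks [OF x] c(2) by (simp add: ac_simps)
  qed
qed

text \<open>The constant \<open>L\<^sub>0 = 1\<close> is eliminated by \<open>Wr[1, f\<^sub>2, \<dots>] = Wr[f\<^sub>2', \<dots>]\<close>; the factors \<open>m' - a\<close>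
  that appear on differentiating are the reason for excluding integers.\<close>

lemma normalized_wronskian_eliminate_1:
  assumes a: "a \<notin> \<int>" and e: "e \<noteq> 0"
  shows "proportional (normalized_wronskian e a (0 # map Suc ns) ms ms' ns') (normalized_wronskian e (a + 1) ns ms ms' (map Suc ns'))"
proof -
  let ?fs = "map (\<lambda>n x. laguerre a (Suc n) (e * x)) ns @
    map (\<lambda>m x. exp (e * x) * laguerre a m (- (e * x))) ms @
    map (\<lambda>m x. x powr (- a) * laguerre (- a) m (e * x)) ms' @
    map (\<lambda>n x. exp (e * x) * x powr (- a) * laguerre (- a) n (- (e * x))) ns'"
  let ?gs = "seeds e (a + 1) ns ms ms' (map Suc ns')"
  have "seeds e a (0 # map Suc ns) ms ms' ns' = (\<lambda>x. 1) # ?fs"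
    by (simp add: seeds_def o_def)
  then have 1: "wronskian (seeds e a (0 # map Suc ns) ms ms' ns') x = wronskian (map deriv ?fs) x" for x
    using wronskian_Cons_1 by metis
  have "list_all2 (\<lambda>f g. \<exists>c. c \<noteq> 0 \<and> (\<forall>y\<in>{0<..}. f y = c * g y)) (map deriv ?fs) ?gs"
    unfolding seeds_def map_append map_map list.rel_map o_def
  proof (intro list_all2_appendI; unfold list.rel_map; intro list.rel_refl_strong)
    fix n
    have "((\<lambda>x. laguerre a (Suc n) (e * x)) has_real_derivative - laguerre (a + 1) n (e * x) * e) (at x)" for x
      by (rule DERIV_chain2 [where g = "\<lambda>x. e * x", OF laguerre_DERIV_Suc])
        (auto intro!: derivative_eq_intros)
    note D = DERIV_imp_deriv [OF this]
    show "\<exists>c. c \<noteq> 0 \<and> (\<forall>y\<in>{0<..}. deriv (\<lambda>x. laguerre a (Suc n) (e * x)) y = c * laguerre (a + 1) n (e * y))"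
      by (intro exI [of _ "- e"]) (use e D in auto)
  next
    fix m
    show "\<exists>c. c \<noteq> 0 \<and> (\<forall>y\<in>{0<..}. deriv (\<lambda>x. exp (e * x) * laguerre a m (- (e * x))) y =
        c * (exp (e * y) * laguerre (a + 1) m (- (e * y))))"
      by (intro exI [of _ e] conjI ballI DERIV_imp_deriv seed2_DERIV e)
  next
    fix m
    have "real m - a \<noteq> 0" using a by auto
    then show "\<exists>c. c \<noteq> 0 \<and> (\<forall>y\<in>{0<..}. deriv (\<lambda>x. x powr (- a) * laguerre (- a) m (e * x)) y =
        c * (y powr (- (a + 1)) * laguerre (- (a + 1)) m (e * y)))"
      by (intro exI [of _ "real m - a"] conjI ballI DERIV_imp_deriv seed3_DERIV) auto
  next
    fix n
    show "\<exists>c. c \<noteq> 0 \<and> (\<forall>y\<in>{0<..}. deriv (\<lambda>x. exp (e * x) * x powr (- a) * laguerre (- a) n (- (e * x))) y =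
        c * (exp (e * y) * y powr (- (a + 1)) * laguerre (- (a + 1)) (Suc n) (- (e * y))))"
      by (intro exI [of _ "real n + 1"] conjI ballI DERIV_imp_deriv seed4_DERIV) auto
  qed
  then obtain C where C: "C \<noteq> 0" "\<And>x. x > 0 \<Longrightarrow> wronskian (map deriv ?fs) x = C * wronskian ?gs x"
    by (rule wronskian_proportional [of "{0<..}", rotated]) (auto intro: smooth_on_seeds)
  \<comment> \<open>The prefactors agree exactly: one seed of type one is lost and the parameter
    grows by one, so the exponent of \<open>x\<close> is the same.\<close>
  show ?thesis
  proof (rule proportionalI [OF C(1)])
    fix x :: real assume "x > 0"
    then show "normalized_wronskian e a (0 # map Suc ns) ms ms' ns' x = C * normalized_wronskian e (a + 1) ns ms ms' (map Suc ns') x"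
      unfolding normalized_wronskian_def 1 C(2) [OF \<open>x > 0\<close>] by (simp add: ac_simps)
  qed
qed

text \<open>The two symmetries turn type four into type one. The elimination there raises -a, that
  is, it lowers \<open>a\<close>.\<close>

lemma normalized_wronskian_eliminate_exp_powr:
  assumes "a \<notin> \<int>" and "e \<noteq> 0"
  shows "proportional (normalized_wronskian e a ns ms ms' (0 # map Suc ns')) (normalized_wronskian e (a - 1) (map Suc ns) ms ms' ns')"
proof -
  have "proportional (normalized_wronskian e a ns ms ms' (0 # map Suc ns')) (normalized_wronskian e (- a) ms' (0 # map Suc ns') ns ms)"
    by (rule normalized_wronskian_neg)
  also have "proportional \<dots> (normalized_wronskian (- e) (- a) (0 # map Suc ns') ms' ms ns)"
    by (rule normalized_wronskian_swap)
  also have "proportional \<dots> (normalized_wronskian (- e) (- a + 1) ns' ms' ms (map Suc ns))"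
    using assms by (intro normalized_wronskian_eliminate_1) auto
  also have "proportional \<dots> (normalized_wronskian (- (- e)) (- a + 1) ms' ns' (map Suc ns) ms)"
    by (rule normalized_wronskian_swap)
  also have "proportional \<dots> (normalized_wronskian (- (- e)) (- (- a + 1)) (map Suc ns) ms ms' ns')"
    by (rule normalized_wronskian_neg)
  finally show ?thesis by simp
qed

section \<open>Shifting Maya diagrams\<close>

definition pos_part :: "int set \<Rightarrow> nat set" where
  "pos_part M = {k. int k \<in> M}"

definition neg_part :: "int set \<Rightarrow> nat set" where
  "neg_part M = {k. - int k - 1 \<notin> M}"

lemma finite_pos_part:
  assumes "maya_diagram M"
  shows "finite (pos_part M)"
proof (rule finite_imageD)
  show "finite (int ` pos_part M)"
    by (rule finite_subset [of _ "{k \<in> M. k \<ge> 0}"])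
      (use assms in \<open>auto simp: maya_diagram_def pos_part_def\<close>)
qed simp

lemma finite_neg_part:
  assumes "maya_diagram M"
  shows "finite (neg_part M)"
proof (rule finite_imageD)
  show "finite ((\<lambda>k. - int k - 1) ` neg_part M)"
    by (rule finite_subset [of _ "{k. k < 0 \<and> k \<notin> M}"])
      (use assms in \<open>auto simp: maya_diagram_def neg_part_def\<close>)
qed (auto simp: inj_on_def)

lemma maya_diagram_iff: "maya_diagram M \<longleftrightarrow> finite (pos_part M) \<and> finite (neg_part M)"
proof
  assume "finite (pos_part M) \<and> finite (neg_part M)"
  moreover have "{k \<in> M. k \<ge> 0} \<subseteq> int ` pos_part M"
    by (auto simp: pos_part_def image_iff) (metis nonneg_int_cases)
  moreover have "{k. k < 0 \<and> k \<notin> M} \<subseteq> (\<lambda>k. - int k - 1) ` neg_part M"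
  proof
    fix k assume "k \<in> {k. k < 0 \<and> k \<notin> M}"
    then have "k = - int (nat (- k - 1)) - 1" "nat (- k - 1) \<in> neg_part M"
      by (auto simp: neg_part_def)
    then show "k \<in> (\<lambda>k. - int k - 1) ` neg_part M" by blast
  qed
  ultimately show "maya_diagram M"
    unfolding maya_diagram_def by (meson finite_imageI finite_subset)
qed (auto intro: finite_pos_part finite_neg_part)

lemma mem_maya_shift: "k \<in> maya_shift M t \<longleftrightarrow> k - t \<in> M"
  unfolding maya_shift_def by (force simp: image_iff)

lemma maya_shift_0 [simp]: "maya_shift M 0 = M"
  by (auto simp: mem_maya_shift)

lemma maya_shift_add: "maya_shift (maya_shift M s) t = maya_shift M (s + t)"
  by (auto simp: mem_maya_shift algebra_simps)

text \<open>Only position -1 crosses the origin. The holes are described for \<open>M\<close> in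
  terms of its shift, so both equations use successors and no predecessor.\<close>

lemma maya_diagram_shift_1:
  "pos_part (maya_shift M 1) = (if - 1 \<in> M then insert 0 (Suc ` pos_part M) else Suc ` pos_part M)"
  "neg_part M = (if - 1 \<in> M then Suc ` neg_part (maya_shift M 1) else insert 0 (Suc ` neg_part (maya_shift M 1)))"
proof -
  have 1: "Suc k \<in> pos_part (maya_shift M 1) \<longleftrightarrow> k \<in> pos_part M" for k
    by (simp add: pos_part_def mem_maya_shift)
  have 2: "0 \<in> pos_part (maya_shift M 1) \<longleftrightarrow> - 1 \<in> M"
    by (simp add: pos_part_def mem_maya_shift)
  have 3: "Suc k \<in> neg_part M \<longleftrightarrow> k \<in> neg_part (maya_shift M 1)" for k
    by (simp add: neg_part_def mem_maya_shift algebra_simps)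
  have 4: "0 \<in> neg_part M \<longleftrightarrow> - 1 \<notin> M"
    by (simp add: neg_part_def)
  have *: "A = (if 0 \<in> A then insert 0 (Suc ` B) else Suc ` B)"
    if "\<And>k. Suc k \<in> A \<longleftrightarrow> k \<in> B" for A B
  proof (rule Set.set_eqI)
    fix k show "k \<in> A \<longleftrightarrow> k \<in> (if 0 \<in> A then insert 0 (Suc ` B) else Suc ` B)"
      using that by (cases k) auto
  qed
  show "pos_part (maya_shift M 1) = (if - 1 \<in> M then insert 0 (Suc ` pos_part M) else Suc ` pos_part M)"
    using * [OF 1] unfolding 2 .
  show "neg_part M = (if - 1 \<in> M then Suc ` neg_part (maya_shift M 1) else insert 0 (Suc ` neg_part (maya_shift M 1)))"
    using * [OF 3] unfolding 4 by (simp add: if_not_P split: if_splits)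
qed

lemma maya_diagram_shift_1_iff: "maya_diagram (maya_shift M 1) \<longleftrightarrow> maya_diagram M"
  unfolding maya_diagram_iff using maya_diagram_shift_1 [of M]
  by (auto split: if_splits simp: finite_image_iff)

lemma maya_diagram_shift:
  assumes "maya_diagram M"
  shows "maya_diagram (maya_shift M t)"
proof (induction t rule: int_induct [where k = 0])
  case base
  then show ?case using assms by simp
next
  case (step1 i)
  then show ?case using maya_diagram_shift_1_iff [of "maya_shift M i"] by (simp add: maya_shift_add)
next
  case (step2 i)
  then show ?case using maya_diagram_shift_1_iff [of "maya_shift M (i - 1)"] by (simp add: maya_shift_add)
qed

lemma sorted_list_of_set_Suc_image:
  assumes "finite A"
  shows "sorted_list_of_set (Suc ` A) = map Suc (sorted_list_of_set A)"
    and "sorted_list_of_set (insert 0 (Suc ` A)) = 0 # map Suc (sorted_list_of_set A)"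
  using assms sorted_list_of_set.idem_if_sorted_distinct [of "map Suc (sorted_list_of_set A)"]
    sorted_list_of_set.idem_if_sorted_distinct [of "0 # map Suc (sorted_list_of_set A)"]
  by (simp_all add: sorted_map distinct_map del: sorted_list_of_set.idem_if_sorted_distinct)

text \<open>\<open>M\<close> supplies types one and four, \<open>N\<close> types two and three.
  Sorting merely fixes an order, which matters only up to sign.\<close>

definition maya_wronskian :: "real \<Rightarrow> real \<Rightarrow> int set \<Rightarrow> int set \<Rightarrow> real \<Rightarrow> real" where
  "maya_wronskian e a M N = normalized_wronskian e a (sorted_list_of_set (pos_part M)) (sorted_list_of_set (pos_part N))
    (sorted_list_of_set (neg_part N)) (sorted_list_of_set (neg_part M))"

lemma maya_wronskian_swap: "proportional (maya_wronskian e a M N) (maya_wronskian (- e) a N M)"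
  unfolding maya_wronskian_def by (rule normalized_wronskian_swap)

text \<open>If -1 is occupied, the shifted diagram has the element 0 and the constant seed is
  eliminated there, so the step is read backwards; otherwise \<open>M\<close> has the hole 0 and the
  seed e^(ex) x^(-a) is eliminated from the original.\<close>

lemma maya_wronskian_shift_1:
  assumes "a \<notin> \<int>" "e \<noteq> 0" "maya_diagram M"
  shows "proportional (maya_wronskian e a M N) (maya_wronskian e (a - 1) (maya_shift M 1) N)"
proof (cases "- 1 \<in> M")
  case True
  have "proportional (maya_wronskian e (a - 1) (maya_shift M 1) N) (maya_wronskian e (a - 1 + 1) M N)"
    unfolding maya_wronskian_def maya_diagram_shift_1 [of M] if_P [OF True]
    using assms finite_pos_part [OF assms(3)]
      finite_neg_part [OF maya_diagram_shift_1_iff [THEN iffD2, OF assms(3)]]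
    by (simp only: sorted_list_of_set_Suc_image) (intro normalized_wronskian_eliminate_1; simp)
  then show ?thesis by (simp add: proportional_sym)
next
  case False
  show ?thesis
    unfolding maya_wronskian_def maya_diagram_shift_1 [of M] if_not_P [OF False]
    using assms finite_pos_part [OF assms(3)]
      finite_neg_part [OF maya_diagram_shift_1_iff [THEN iffD2, OF assms(3)]]
    by (simp only: sorted_list_of_set_Suc_image) (intro normalized_wronskian_eliminate_exp_powr; simp)
qed

lemma maya_wronskian_shift_left:
  assumes "a \<notin> \<int>" "e \<noteq> 0" "maya_diagram M"
  shows "proportional (maya_wronskian e a M N) (maya_wronskian e (a - of_int t) (maya_shift M t) N)"
proof -
  \<comment> \<open>Integer shifts keep the parameter non-integral, so the unit step is available
    throughout the induction, in both directions.\<close>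
  have a: "a - of_int i \<notin> \<int>" for i
    using assms(1) by (metis Ints_add Ints_of_int diff_add_cancel)
  show ?thesis
  proof (induction t rule: int_induct [where k = 0])
    case base
    then show ?case by (simp add: proportional_refl)
  next
    case (step1 i)
    from maya_wronskian_shift_1 [OF a assms(2) maya_diagram_shift [OF assms(3)], of i i N] step1
    show ?case by (auto simp: maya_shift_add algebra_simps intro: proportional_trans)
  next
    case (step2 i)
    from maya_wronskian_shift_1 [OF a assms(2) maya_diagram_shift [OF assms(3)], of "i - 1" "i - 1" N] step2
    show ?case by (auto simp: maya_shift_add algebra_simps intro: proportional_trans proportional_sym)
  qed
qed

text \<open>The second diagram is moved by bringing it into first place with
  \<open>maya_wronskian_swap\<close> and back again.\<close>

lemma maya_wronskian_shift:
  assumes "a \<notin> \<int>" "e \<noteq> 0" "maya_diagram M" "maya_diagram N"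
  shows "proportional (maya_wronskian e a M N) (maya_wronskian e (a - of_int s - of_int t) (maya_shift M s) (maya_shift N t))"
proof -
  have a: "a - of_int s \<notin> \<int>"
    using assms(1) by (metis Ints_add Ints_of_int diff_add_cancel)
  have "proportional (maya_wronskian e a M N) (maya_wronskian e (a - of_int s) (maya_shift M s) N)"
    using assms by (intro maya_wronskian_shift_left)
  also have "proportional \<dots> (maya_wronskian (- e) (a - of_int s) N (maya_shift M s))"
    by (rule maya_wronskian_swap)
  also have "proportional \<dots> (maya_wronskian (- e) (a - of_int s - of_int t) (maya_shift N t) (maya_shift M s))"
    using assms a by (intro maya_wronskian_shift_left) auto
  also have "proportional \<dots> (maya_wronskian (- (- e)) (a - of_int s - of_int t) (maya_shift M s) (maya_shift N t))"
    by (rule maya_wronskian_swap)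
  finally show ?thesis by simp
qed


section \<open>Non-vanishing\<close>

text \<open>Denominators are allowed because the elimination divides by one of the
  functions.\<close>

definition exp_rat :: "real \<times> real poly \<times> real poly \<Rightarrow> real \<Rightarrow> real" where
  "exp_rat = (\<lambda>(b, p, q) x. exp (b * x) * poly p x / poly q x)"

text \<open>The key \<open>(b, d)\<close> records the growth \<open>e\<^sup>b\<^sup>x x\<^sup>d\<close> at infinity. Distinctness of keys survives
  dividing by one member and differentiating, which drives the elimination below.\<close>

definition exp_rat_key :: "real \<times> real poly \<times> real poly \<Rightarrow> real \<times> int" where
  "exp_rat_key = (\<lambda>(b, p, q). (b, int (degree p) - int (degree q)))"

definition exp_rat_deriv :: "real \<times> real poly \<times> real poly \<Rightarrow> real \<times> real poly \<times> real poly" where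
  "exp_rat_deriv = (\<lambda>(b, p, q). (b, smult b (p * q) + (pderiv p * q - p * pderiv q), q * q))"

lemma exp_rat_DERIV:
  assumes "poly q x \<noteq> 0"
  shows "(exp_rat (b, p, q) has_real_derivative exp_rat (exp_rat_deriv (b, p, q)) x) (at x)"
proof -
  have "((\<lambda>x. exp (b * x) * poly p x / poly q x) has_real_derivative
      exp (b * x) * (b * (poly p x * poly q x) + (poly (pderiv p) x * poly q x - poly p x * poly (pderiv q) x)) /
        (poly q x * poly q x)) (at x)"
    using assms
    by (auto intro!: derivative_eq_intros poly_DERIV [THEN DERIV_cong] simp: field_simps)
  then show ?thesis
    by (simp add: exp_rat_def exp_rat_deriv_def)
qed

lemma smooth_on_exp_rat:
  assumes "open S" "\<And>x. x \<in> S \<Longrightarrow> poly q x \<noteq> 0"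
  shows "smooth_on S (exp_rat (b, p, q))"
proof (rule smooth_on_closed_class [where P = "\<lambda>g. \<exists>b p q. (\<forall>x\<in>S. poly q x \<noteq> 0) \<and> g = exp_rat (b, p, q)"])
  fix g assume "\<exists>b p q. (\<forall>x\<in>S. poly q x \<noteq> 0) \<and> g = exp_rat (b, p, q)"
  then obtain b p q where q: "\<forall>x\<in>S. poly q x \<noteq> 0" "g = exp_rat (b, p, q)" by blast
  have "\<forall>x\<in>S. (g has_real_derivative exp_rat (exp_rat_deriv (b, p, q)) x) (at x)"
    using q exp_rat_DERIV by blast
  moreover have "\<forall>x\<in>S. poly (q * q) x \<noteq> 0" using q by simp
  ultimately show "\<exists>h. (\<exists>b p q. (\<forall>x\<in>S. poly q x \<noteq> 0) \<and> h = exp_rat (b, p, q)) \<and>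
      (\<forall>x\<in>S. (g has_real_derivative h x) (at x))"
    unfolding exp_rat_deriv_def prod.case by blast
qed (use assms in auto)

lemma degree_pderiv_mult_le:
  fixes p q :: "real poly"
  shows "degree (pderiv p * q) \<le> degree p + degree q - 1"
proof (cases "degree p = 0")
  case True
  then have "pderiv p = 0" by (simp add: pderiv_eq_0_iff)
  then show ?thesis by simp
next
  case False
  then show ?thesis using degree_mult_le [of "pderiv p" q] by (simp add: degree_pderiv)
qed

lemma coeff_pderiv_mult:
  fixes p q :: "real poly"
  shows "coeff (pderiv p * q) (degree p + degree q - 1) = real (degree p) * lead_coeff p * lead_coeff q"
proof (cases "degree p = 0")
  case True
  then have "pderiv p = 0" by (simp add: pderiv_eq_0_iff)
  with True show ?thesis by simp
next
  case False
  then have n: "degree p + degree q - 1 = degree (pderiv p) + degree q" by (simp add: degree_pderiv)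
  from False show ?thesis unfolding n coeff_mult_degree_sum by (simp add: coeff_pderiv degree_pderiv)
qed

text \<open>For b \<noteq> 0 the term b p q dominates. For b = 0 the leading candidate of p' q - p
  q' carries the factor deg p - deg q, which the excluded key (0, 0) keeps away from zero.\<close>

lemma exp_rat_key_deriv:
  assumes p: "p \<noteq> 0" and q: "q \<noteq> 0" and key: "exp_rat_key (b, p, q) \<noteq> (0, 0)"
  defines "d \<equiv> int (degree p) - int (degree q)"
  shows "exp_rat_key (exp_rat_deriv (b, p, q)) = (b, if b = 0 then d - 1 else d)"
    and "fst (snd (exp_rat_deriv (b, p, q))) \<noteq> 0"
proof -
  let ?r = "pderiv p * q - p * pderiv q" and ?n = "degree p + degree q"
  have r: "degree ?r \<le> ?n - 1"
    using degree_pderiv_mult_le [of p q] degree_pderiv_mult_le [of q p]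
    by (intro degree_diff_le) (simp_all add: mult.commute add.commute)
  have qq: "degree (q * q) = degree q + degree q" using q by (simp add: degree_mult_eq)
  have "exp_rat_key (exp_rat_deriv (b, p, q)) = (b, if b = 0 then d - 1 else d) \<and>
      fst (snd (exp_rat_deriv (b, p, q))) \<noteq> 0"
  proof (cases "b = 0")
    case True
    with key have ne: "degree p \<noteq> degree q" by (simp add: exp_rat_key_def)
    have "coeff ?r (?n - 1) = (real (degree p) - real (degree q)) * lead_coeff p * lead_coeff q"
      using coeff_pderiv_mult [of p q] coeff_pderiv_mult [of q p]
      by (simp add: algebra_simps)
    then have c: "coeff ?r (?n - 1) \<noteq> 0" using ne p q by simp
    then have "degree ?r = ?n - 1" using r le_degree by (metis order_antisym)
    moreover have "?r \<noteq> 0" using c by (metis coeff_0)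
    moreover have "?n \<ge> 1" using ne by linarith
    ultimately show ?thesis
      using True by (simp add: exp_rat_key_def exp_rat_deriv_def qq d_def of_nat_diff)
  next
    case False
    have pq: "degree (smult b (p * q)) = ?n" using False p q by (simp add: degree_mult_eq)
    have "degree (smult b (p * q) + ?r) = ?n \<and> smult b (p * q) + ?r \<noteq> 0"
    proof (cases "?n = 0")
      \<comment> \<open>Truncated subtraction makes the bound \<open>?n - 1\<close> no longer strict
        here, but both derivatives vanish.\<close>
      case True
      then have "pderiv p = 0" "pderiv q = 0" by (simp_all add: pderiv_eq_0_iff)
      with pq False p q show ?thesis by simp
    next
      case n: False
      then have "degree ?r < degree (smult b (p * q))" using r unfolding pq by linarith
      then have "degree (smult b (p * q) + ?r) = ?n" using pq by (metis degree_add_eq_left)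
      with n show ?thesis by (metis degree_0)
    qed
    then show ?thesis
      using False by (simp add: exp_rat_key_def exp_rat_deriv_def qq d_def)
  qed
  then show "exp_rat_key (exp_rat_deriv (b, p, q)) = (b, if b = 0 then d - 1 else d)"
    "fst (snd (exp_rat_deriv (b, p, q))) \<noteq> 0" by auto
qed

lemma poly_nonzero_beyond:
  fixes p :: "real poly"
  assumes "p \<noteq> 0"
  obtains X where "\<And>x. x > X \<Longrightarrow> poly p x \<noteq> 0"
proof -
  have fin: "finite (insert 0 {x. poly p x = 0})" using poly_roots_finite [OF assms] by simp
  have "poly p x \<noteq> 0" if "x > Max (insert 0 {x. poly p x = 0})" for x
    using Max_ge [OF fin, of x] that by auto
  then show thesis by (rule that)
qed

text \<open>The claim covers all large \<open>x\<close>, not just one point, so that in each round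
  of the induction finitely many poles and zeros can be passed over by enlarging the bound.\<close>

lemma wronskian_exp_rat_nonzero:
  assumes "\<And>b p q. (b, p, q) \<in> set ts \<Longrightarrow> p \<noteq> 0 \<and> q \<noteq> 0" and "distinct (map exp_rat_key ts)"
  shows "\<exists>X. \<forall>x>X. wronskian (map exp_rat ts) x \<noteq> 0"
  using assms
proof (induction "length ts" arbitrary: ts)
  case 0
  then show ?case by (simp add: wronskian_def)
next
  case (Suc n)
  obtain b\<^sub>1 p\<^sub>1 q\<^sub>1 us where ts: "ts = (b\<^sub>1, p\<^sub>1, q\<^sub>1) # us"
    using Suc.hyps(2) by (metis length_Suc_conv prod_cases3)
  \<comment> \<open>\<open>g\<close> divides by the first function; \<open>vs\<close> consists of
    the derivatives of the quotients.\<close>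
  define g where "g = (\<lambda>(b, p, q). (b - b\<^sub>1, p * q\<^sub>1, q * p\<^sub>1))"
  define vs where "vs = map (\<lambda>t. exp_rat_deriv (g t)) us"
  have nz1: "p\<^sub>1 \<noteq> 0" "q\<^sub>1 \<noteq> 0" using Suc.prems(1) [of b\<^sub>1 p\<^sub>1 q\<^sub>1] ts by auto
  \<comment> \<open>All keys are translated alike, except that rate \<open>b\<^sub>1\<close> costs
    one more degree. That correction depends on the rate alone, so distinct keys stay distinct. No
    quotient has key (0, 0), since its key differed from the first one.\<close>
  have key: "exp_rat_key (exp_rat_deriv (g t)) =
      (fst (exp_rat_key t) - b\<^sub>1, snd (exp_rat_key t) - (int (degree p\<^sub>1) - int (degree q\<^sub>1)) -
        (if fst (exp_rat_key t) = b\<^sub>1 then 1 else 0))"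
    and nz: "fst (snd (exp_rat_deriv (g t))) \<noteq> 0" "snd (snd (exp_rat_deriv (g t))) \<noteq> 0"
    if "t \<in> set us" for t
  proof -
    obtain b p q where t: "t = (b, p, q)" by (metis prod_cases3)
    have pq: "p \<noteq> 0" "q \<noteq> 0" using Suc.prems(1) [of b p q] ts t that by auto
    have "exp_rat_key t \<noteq> exp_rat_key (b\<^sub>1, p\<^sub>1, q\<^sub>1)"
      using Suc.prems(2) that unfolding ts list.map distinct.simps set_map by (metis image_eqI)
    moreover have deg: "degree (p * q\<^sub>1) = degree p + degree q\<^sub>1" "degree (q * p\<^sub>1) = degree q + degree p\<^sub>1"
      using pq nz1 by (simp_all add: degree_mult_eq)
    ultimately have ne: "exp_rat_key (b - b\<^sub>1, p * q\<^sub>1, q * p\<^sub>1) \<noteq> (0, 0)"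
      by (auto simp: exp_rat_key_def t)
    have "p * q\<^sub>1 \<noteq> 0" "q * p\<^sub>1 \<noteq> 0" using pq nz1 by simp_all
    note D = exp_rat_key_deriv [OF this ne]
    show "exp_rat_key (exp_rat_deriv (g t)) =
      (fst (exp_rat_key t) - b\<^sub>1, snd (exp_rat_key t) - (int (degree p\<^sub>1) - int (degree q\<^sub>1)) -
        (if fst (exp_rat_key t) = b\<^sub>1 then 1 else 0))"
      using D(1) by (simp add: g_def t deg) (simp add: exp_rat_key_def)
    show "fst (snd (exp_rat_deriv (g t))) \<noteq> 0" using D(2) by (simp add: g_def t)
    show "snd (snd (exp_rat_deriv (g t))) \<noteq> 0" using pq nz1 by (simp add: g_def t exp_rat_deriv_def)
  qed
  have "distinct (map exp_rat_key vs)"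
  proof -
    have inj: "inj_on exp_rat_key (set us)" "distinct us"
      using Suc.prems(2) by (auto simp: ts distinct_map)
    have "inj_on (\<lambda>t. exp_rat_key (exp_rat_deriv (g t))) (set us)"
    proof (rule inj_onI)
      fix t u assume tu: "t \<in> set us" "u \<in> set us"
        "exp_rat_key (exp_rat_deriv (g t)) = exp_rat_key (exp_rat_deriv (g u))"
      then have "exp_rat_key t = exp_rat_key u"
        by (auto simp: key prod_eq_iff)
      with inj tu show "t = u" by (auto dest: inj_onD)
    qed
    with inj show ?thesis by (simp add: vs_def distinct_map o_def inj_on_def)
  qed
  moreover have "p \<noteq> 0 \<and> q \<noteq> 0" if "(b, p, q) \<in> set vs" for b p q
    using that nz unfolding vs_def by (auto simp: image_iff) (metis fst_conv snd_conv)+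
  moreover have "n = length vs" using Suc.hyps(2) by (simp add: ts vs_def)
  ultimately obtain X\<^sub>1 where X1: "\<And>x. x > X\<^sub>1 \<Longrightarrow> wronskian (map exp_rat vs) x \<noteq> 0"
    using Suc.hyps(1) by metis
  \<comment> \<open>\<open>r\<close> collects the polynomials that must not vanish: every
    denominator, and the numerator \<open>p\<^sub>1\<close>, which becomes a denominator after the
    division.\<close>
  define r where "r = p\<^sub>1 * q\<^sub>1 * prod_list (map (\<lambda>(b, p, q). q) us)"
  have "r \<noteq> 0"
    using nz1 Suc.prems(1) unfolding r_def ts by (fastforce simp: prod_list_zero_iff)
  then obtain X\<^sub>2 where X2: "\<And>x. x > X\<^sub>2 \<Longrightarrow> poly r x \<noteq> 0"
    by (metis poly_nonzero_beyond)
  define S where "S = {X\<^sub>2<..}"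
  have S: "open S" by (simp add: S_def)
  have S1: "poly p\<^sub>1 x \<noteq> 0" "poly q\<^sub>1 x \<noteq> 0" if "x \<in> S" for x
    using X2 [of x] that by (auto simp: S_def r_def)
  have Sq: "poly q x \<noteq> 0" if "x \<in> S" "(b, p, q) \<in> set us" for x b p q
  proof -
    have "q dvd prod_list (map (\<lambda>(b, p, q). q) us)"
      using that(2) by (intro prod_list_dvd) force
    then have "q dvd r" by (simp add: r_def)
    then show ?thesis using X2 [of x] that(1) by (auto simp: S_def dvd_def)
  qed
  let ?h = "exp_rat (b\<^sub>1, p\<^sub>1, q\<^sub>1)"
  let ?gs = "(\<lambda>x. 1) # map (\<lambda>t. exp_rat (g t)) us"
  have "wronskian (map exp_rat ts) x \<noteq> 0" if x: "x > max X\<^sub>1 X\<^sub>2" for x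
  proof -
    have xS: "x \<in> S" using x by (simp add: S_def)
    have eq: "exp_rat t y = ?h y * exp_rat (g t) y" if "y \<in> S" "t \<in> set us" for t y
    proof -
      obtain b p q where t: "t = (b, p, q)" by (metis prod_cases3)
      show ?thesis
        using S1 [OF that(1)] Sq [OF that(1), of b p q] that(2)
        by (simp add: t exp_rat_def g_def left_diff_distrib exp_diff)
    qed
    have smooth: "smooth_on S (exp_rat (g t))" if "t \<in> set us" for t
    proof -
      obtain b p q where t: "t = (b, p, q)" by (metis prod_cases3)
      show ?thesis
        unfolding g_def t prod.case using S1 Sq [of _ b p q] that t
        by (intro smooth_on_exp_rat S) auto
    qed
    have D: "deriv (exp_rat (g t)) y = exp_rat (exp_rat_deriv (g t)) y" if "y \<in> S" "t \<in> set us" for t y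
    proof -
      obtain b p q where t: "t = (b, p, q)" by (metis prod_cases3)
      show ?thesis
        unfolding g_def t prod.case using S1 [OF that(1)] Sq [OF that(1), of b p q] that(2) t
        by (intro DERIV_imp_deriv exp_rat_DERIV) auto
    qed
    have "wronskian (map exp_rat ts) x = wronskian (map (\<lambda>f y. ?h y * f y) ?gs) x"
      by (rule wronskian_cong [OF S xS])
        (use eq in \<open>auto simp: ts list.rel_map intro!: list.rel_refl_strong\<close>)
    also have "\<dots> = ?h x ^ length ?gs * wronskian ?gs x"
      using S1 smooth by (intro wronskian_mult [OF S xS] smooth_on_exp_rat S) auto
    also have "wronskian ?gs x = wronskian (map deriv (map (\<lambda>t. exp_rat (g t)) us)) x"
      by (rule wronskian_Cons_1)
    also have "\<dots> = wronskian (map exp_rat vs) x"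
      by (rule wronskian_cong [OF S xS])
        (use D in \<open>auto simp: vs_def list.rel_map intro!: list.rel_refl_strong\<close>)
    finally show ?thesis
      using X1 [of x] x S1 [OF xS] by (simp add: exp_rat_def)
  qed
  then show ?case by blast
qed

section \<open>Growth of the polynomial seeds\<close>

definition laguerre_poly :: "real \<Rightarrow> nat \<Rightarrow> real \<Rightarrow> real poly" where
  "laguerre_poly a n d = (\<Sum>k\<le>n. monom (((real n + a) gchoose (n - k)) * (- d) ^ k / fact k) k)"

lemma poly_laguerre_poly: "poly (laguerre_poly a n d) x = laguerre a n (d * x)"
  unfolding laguerre_poly_def laguerre_def
  by (simp add: poly_sum poly_monom flip: power_mult_distrib times_divide_eq_left mult.assoc)
    (simp add: power_mult_distrib [symmetric] mult.assoc)

text \<open>The leading coefficient (-d)^n / n! does not involve \<open>a\<close>, so the degree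
  does not drop at any parameter, integral ones included.\<close>

lemma degree_laguerre_poly:
  assumes "d \<noteq> 0"
  shows "degree (laguerre_poly a n d) = n" "laguerre_poly a n d \<noteq> 0"
proof -
  have "coeff (laguerre_poly a n d) n = (- d) ^ n / fact n"
    unfolding laguerre_poly_def by (simp add: coeff_sum)
  with assms have c: "coeff (laguerre_poly a n d) n \<noteq> 0" by simp
  moreover have "degree (laguerre_poly a n d) \<le> n"
    unfolding laguerre_poly_def by (intro degree_sum_le) (auto intro: order_trans [OF degree_monom_le])
  ultimately show "degree (laguerre_poly a n d) = n" by (meson le_antisym le_degree)
  show "laguerre_poly a n d \<noteq> 0" using c by (metis coeff_0)
qed

text \<open>The keys are (0, n) for type one and (e, m) for type two, and e \<noteq> 0 separates the
  two types.\<close>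

lemma wronskian_seeds_nonzero:
  assumes "e \<noteq> 0" "distinct ns" "distinct ms"
  obtains x where "x > 0" "wronskian (seeds e a ns ms [] []) x \<noteq> 0"
proof -
  define ts :: "(real \<times> real poly \<times> real poly) list"
    where "ts = map (\<lambda>n. (0, laguerre_poly a n e, 1)) ns @ map (\<lambda>m. (e, laguerre_poly a m (- e), 1)) ms"
  have "seeds e a ns ms [] [] = map exp_rat ts"
    by (auto simp: seeds_def ts_def exp_rat_def poly_laguerre_poly)
  moreover have "distinct (map exp_rat_key ts)"
    using assms by (auto simp: ts_def exp_rat_key_def distinct_map inj_on_def degree_laguerre_poly)
  moreover have "p \<noteq> 0 \<and> q \<noteq> 0" if "(b, p, q) \<in> set ts" for b p q
    using that assms(1) by (auto simp: ts_def degree_laguerre_poly)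
  ultimately obtain X where X: "\<And>x. x > X \<Longrightarrow> wronskian (seeds e a ns ms [] []) x \<noteq> 0"
    using wronskian_exp_rat_nonzero [of ts] by metis
  show thesis using that [of "max X 0 + 1"] X by simp
qed


section \<open>Partitions and conjugation\<close>

lemma mem_maya_of:
  "k \<in> maya_of ns' ns \<longleftrightarrow> (if k \<ge> 0 then nat k \<in> set ns else nat (- k - 1) \<notin> set ns')"
  by (auto simp: maya_of_def image_iff) (metis int_nat_eq nonneg_int_cases)+

definition maya_std :: "int set \<Rightarrow> int set" where
  "maya_std M = maya_shift M (maya_t M)"

lemma maya_t:
  assumes "maya_diagram M"
  shows "k < 0 \<Longrightarrow> k \<in> maya_std M" "0 \<notin> maya_std M"
  using theI' [OF maya_t_ex1 [OF assms]] by (auto simp: maya_t_def maya_std_def)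

lemma maya_t_eqI:
  assumes "maya_diagram M" "\<And>k. k < 0 \<Longrightarrow> k \<in> maya_shift M t" "0 \<notin> maya_shift M t"
  shows "maya_t M = t"
  unfolding maya_t_def by (rule the1_equality [OF maya_t_ex1 [OF assms(1)]]) (use assms in auto)

lemma maya_diagram_std: "maya_diagram M \<Longrightarrow> maya_diagram (maya_std M)"
  unfolding maya_std_def by (rule maya_diagram_shift)

definition maya_desc :: "int set \<Rightarrow> nat list" where
  "maya_desc M = rev (sorted_list_of_set (pos_part (maya_std M)))"

lemma maya_desc:
  assumes "maya_diagram M"
  shows "set (maya_desc M) = pos_part (maya_std M)" "sorted_wrt (>) (maya_desc M)"
  using finite_pos_part [OF maya_diagram_std [OF assms]]
  by (simp_all add: maya_desc_def sorted_wrt_rev)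

lemma distinct_maya_desc: "distinct (maya_desc M)"
  by (simp add: maya_desc_def)

section \<open>Counting in decreasing lists and the parts of a diagram\<close>

lemma card_less_desc:
  fixes xs :: "nat list"
  assumes "sorted_wrt (>) xs" "j < length xs"
  shows "card {x \<in> set xs. x < xs ! j} = length xs - Suc j"
proof -
  have lt: "xs ! i < xs ! j \<longleftrightarrow> j < i" if "i < length xs" for i
    using assms that sorted_wrt_nth_less [OF assms(1)]
    by (metis less_asym nat_neq_iff order_less_irrefl)
  have "distinct xs" using assms(1) by (induction xs) auto
  have "{x \<in> set xs. x < xs ! j} = (!) xs ` {Suc j..<length xs}"
    using lt by (force simp: in_set_conv_nth)
  then show ?thesis
    using inj_on_nth [OF \<open>distinct xs\<close>, of "{Suc j..<length xs}"] by (simp add: card_image)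
qed

text \<open>The entries above \<open>a\<close> form an initial segment of a decreasing list. This
  trades comparisons of entries for counts, which is how conjugation is verified.\<close>

lemma nth_less_iff_card:
  fixes xs :: "nat list"
  assumes "sorted_wrt (>) xs" "j < length xs"
  shows "a < xs ! j \<longleftrightarrow> j < card {x \<in> set xs. a < x}"
proof -
  have "distinct xs" using assms(1) by (induction xs) auto
  have mono: "xs ! i \<ge> xs ! k" if "i \<le> k" "k < length xs" for i k
    using sorted_wrt_nth_less [OF assms(1), of i k] that by (cases "i = k") auto
  have inj: "card ((!) xs ` I) = card I" if "I \<subseteq> {..<length xs}" for I
    by (rule card_image) (use inj_on_nth [OF \<open>distinct xs\<close>] that in auto)
  show ?thesis
  proof
    assume a: "a < xs ! j"
    have "(!) xs ` {..j} \<subseteq> {x \<in> set xs. a < x}"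
      using a mono [of _ j] assms(2) by (auto intro: less_le_trans)
    then have "card ((!) xs ` {..j}) \<le> card {x \<in> set xs. a < x}" by (intro card_mono) auto
    then show "j < card {x \<in> set xs. a < x}" 
      using assms(2) inj [of "{..j}"] by (simp add: lessThan_Suc_atMost [symmetric])
  next
    assume j: "j < card {x \<in> set xs. a < x}"
    show "a < xs ! j"
    proof (rule ccontr)
      assume na: "\<not> a < xs ! j"
      have "{x \<in> set xs. a < x} \<subseteq> (!) xs ` {..<j}"
      proof
        fix x assume "x \<in> {x \<in> set xs. a < x}"
        then obtain i where i: "i < length xs" "x = xs ! i" "a < xs ! i"
          by (auto simp: in_set_conv_nth)
        then have "i < j" using mono [of j i] na by (meson leI le_trans not_le)
        with i show "x \<in> (!) xs ` {..<j}" by auto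
      qed
      then have "card {x \<in> set xs. a < x} \<le> card ((!) xs ` {..<j})" by (intro card_mono) auto
      also have "\<dots> \<le> j" using card_image_le [of "{..<j}" "(!) xs"] by simp
      finally show False using j by simp
    qed
  qed
qed

lemma maya_partition_eq:
  "maya_partition M = map (\<lambda>j. nat (int (maya_desc M ! (j - 1)) - int (length (maya_desc M)) + int j))
    [1..<length (maya_desc M) + 1]"
proof -
  have "{k \<in> maya_std M. k \<ge> 0} = int ` pos_part (maya_std M)"
    by (auto simp: pos_part_def image_iff) (metis nonneg_int_cases)
  moreover have "sorted_list_of_set (int ` pos_part (maya_std M)) =
      map int (sorted_list_of_set (pos_part (maya_std M)))"
  proof (cases "finite (pos_part (maya_std M))")
    case True
    then show ?thesis
      using sorted_list_of_set.idem_if_sorted_distinct [of "map int (sorted_list_of_set (pos_part (maya_std M)))"]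
      by (simp add: sorted_map distinct_map del: sorted_list_of_set.idem_if_sorted_distinct)
  next
    case False
    then have "infinite (int ` pos_part (maya_std M))" by (simp add: finite_image_iff)
    with False show ?thesis by simp
  qed
  ultimately have N: "rev (sorted_list_of_set {k \<in> maya_std M. k \<ge> 0}) = map int (maya_desc M)"
    by (simp add: maya_desc_def rev_map)
  show ?thesis
    unfolding maya_partition_def Let_def maya_std_def [symmetric] N
    by (simp del: upt_Suc) (intro ballI, subst nth_map, auto)
qed

lemma length_maya_partition [simp]: "length (maya_partition M) = length (maya_desc M)"
  by (simp add: maya_partition_eq del: upt_Suc)

text \<open>The first identity recovers N_j = \<lambda>_j + p - j, the degrees in the exceptional
  polynomial (list positions start at 0, hence \<open>Suc j\<close>). The second reads a part as the
  number of gaps below its element, the form suited to conjugation.\<close>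

lemma maya_partition_nth:
  assumes "maya_diagram M" "j < length (maya_desc M)"
  shows "maya_partition M ! j + length (maya_desc M) = maya_desc M ! j + Suc j"
    and "maya_partition M ! j = card ({..<maya_desc M ! j} - pos_part (maya_std M))"
proof -
  let ?n = "maya_desc M" and ?A = "pos_part (maya_std M)"
  have "card {x \<in> ?A. x < ?n ! j} = length ?n - Suc j"
    using card_less_desc [OF maya_desc(2) [OF assms(1)] assms(2)] by (simp add: maya_desc(1) [OF assms(1)])
  moreover have "{x \<in> ?A. x < ?n ! j} = {..<?n ! j} \<inter> ?A" by auto
  ultimately have c: "card ({..<?n ! j} \<inter> ?A) = length ?n - Suc j" by simp
  then have le: "length ?n - Suc j \<le> ?n ! j"
    using card_mono [of "{..<?n ! j}" "{..<?n ! j} \<inter> ?A"] by simp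
  have nth: "maya_partition M ! j = nat (int (?n ! j) - int (length ?n) + int j + 1)"
    using assms(2) by (simp add: maya_partition_eq add.commute del: upt_Suc)
  then show 1: "maya_partition M ! j + length ?n = ?n ! j + Suc j"
    using le assms(2) by linarith
  have "card ({..<?n ! j} - ?A) = ?n ! j - (length ?n - Suc j)"
    by (simp add: card_Diff_subset_Int c)
  then show "maya_partition M ! j = card ({..<?n ! j} - ?A)"
    using 1 le assms(2) by linarith
qed

text \<open>Complement and reflection about -1/2: the exchange of particles and holes.\<close>

definition maya_conj :: "int set \<Rightarrow> int set" where
  "maya_conj M = {k. - k - 1 \<notin> M}"

lemma maya_conj_maya_of: "maya_conj (maya_of ns' ns) = maya_of ns ns'"
  by (auto simp: maya_conj_def mem_maya_of)

lemma maya_diagram_conj: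
  assumes "maya_diagram M"
  shows "maya_diagram (maya_conj M)"
proof -
  have "{k \<in> maya_conj M. k \<ge> 0} \<subseteq> (\<lambda>k. - k - 1) ` {k. k < 0 \<and> k \<notin> M}"
    by (force simp: maya_conj_def)
  moreover have "{k. k < 0 \<and> k \<notin> maya_conj M} \<subseteq> (\<lambda>k. - k - 1) ` {k \<in> M. k \<ge> 0}"
    by (force simp: maya_conj_def)
  ultimately show ?thesis
    using assms unfolding maya_diagram_def by (meson finite_imageI finite_subset)
qed

text \<open>The lowest hole of the conjugate is the reflection of the largest element of
  \<open>M\<close>. Hence the n_1 + 1 and m_1 + 1 in (c) and (d), and the 2 in \<alpha>'.\<close>

lemma maya_t_conj:
  assumes "maya_diagram M"
  shows "maya_t (maya_conj M) = maya_largest M + 1"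
proof (rule maya_t_eqI [OF maya_diagram_conj [OF assms]])
  show "k \<in> maya_shift (maya_conj M) (maya_largest M + 1)" if "k < 0" for k
    using maya_largest(2) [OF assms, of "maya_largest M - k"] that
    by (auto simp: mem_maya_shift maya_conj_def)
  show "0 \<notin> maya_shift (maya_conj M) (maya_largest M + 1)"
    using maya_largest(1) [OF assms] by (simp add: mem_maya_shift maya_conj_def)
qed

section \<open>Conjugate partitions\<close>

lemma nth_conj_partition:
  assumes "i < length (conj_partition la)"
  shows "conj_partition la ! i = card {j. j < length la \<and> i < la ! j}"
proof -
  have "{j \<in> {1..length la}. la ! (j - 1) \<ge> Suc i} = Suc ` {j. j < length la \<and> i < la ! j}"
  proof (intro Set.set_eqI iffI)
    fix j assume "j \<in> {j \<in> {1..length la}. la ! (j - 1) \<ge> Suc i}"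
    then show "j \<in> Suc ` {j. j < length la \<and> i < la ! j}" by (cases j) auto
  qed auto
  then show ?thesis
    using assms by (simp add: conj_partition_def card_image del: upt_Suc)
qed

text \<open>Double count of the cells of the Young diagram; the largest part \<open>c\<close> bounds
  the column index.\<close>

lemma sum_list_conj_partition:
  assumes "is_partition la"
  shows "sum_list (conj_partition la) = sum_list la"
proof -
  define c where "c = (case la of [] \<Rightarrow> 0 | l # _ \<Rightarrow> l)"
  have c: "l \<le> c" if "l \<in> set la" for l
    using that assms by (cases la) (auto simp: c_def is_partition_def)
  have len: "length (conj_partition la) = c"
    by (simp add: conj_partition_def c_def)
  have "sum_list (conj_partition la) = (\<Sum>i<c. card {j. j < length la \<and> i < la ! j})"
    unfolding sum_list_sum_nth len atLeast0LessThan by (rule sum.cong) (simp_all add: len nth_conj_partition)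
  also have "\<dots> = (\<Sum>i<c. \<Sum>j<length la. if i < la ! j then 1 else 0)"
    by (rule sum.cong) (simp_all add: sum.If_cases Collect_conj_eq lessThan_def)
  also have "\<dots> = (\<Sum>j<length la. \<Sum>i<c. if i < la ! j then 1 else 0)"
    by (rule sum.swap)
  also have "\<dots> = (\<Sum>j<length la. la ! j)"
  proof (rule sum.cong)
    fix j assume "j \<in> {..<length la}"
    then have "{..<c} \<inter> {i. i < la ! j} = {..<la ! j}" using c [of "la ! j"] by auto
    then show "(\<Sum>i<c. if i < la ! j then 1 else 0) = la ! j" by (simp add: sum.If_cases)
  qed simp
  finally show ?thesis by (simp add: sum_list_sum_nth atLeast0LessThan)
qed

text \<open>\<open>B\<close> is the complement of \<open>A\<close> in {0..l}, reflected. If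
  \<open>A\<close> lies in {0..l} the relation is symmetric, so the count can be applied to a
  diagram and to its conjugate.\<close>

lemma card_reflect:
  fixes A B :: "nat set"
  assumes B: "\<And>k. k \<in> B \<longleftrightarrow> k \<le> l \<and> l - k \<notin> A" and n: "n \<le> l"
  shows "card ({..<n} - A) = card {h \<in> B. l - n < h}"
proof -
  have "{h \<in> B. l - n < h} = (\<lambda>g. l - g) ` ({..<n} - A)"
  proof (intro Set.set_eqI iffI)
    fix h assume "h \<in> {h \<in> B. l - n < h}"
    then have h: "h \<le> l" "l - h \<notin> A" "l - n < h" by (auto simp: B)
    then have "l - h < n" "h = l - (l - h)" using n by linarith+
    with h(2) show "h \<in> (\<lambda>g. l - g) ` ({..<n} - A)" by blast
  next
    fix h assume "h \<in> (\<lambda>g. l - g) ` ({..<n} - A)"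
    then obtain g where g: "g < n" "g \<notin> A" "h = l - g" by blast
    then have "l - h = g" "h \<le> l" "l - n < h" using n by linarith+
    with g(2) show "h \<in> {h \<in> B. l - n < h}" unfolding mem_Collect_eq B by simp
  qed
  moreover have "inj_on (\<lambda>g. l - g) ({..<n} - A)" using n by (auto intro!: inj_onI)
  ultimately show ?thesis by (simp add: card_image)
qed

text \<open>Up to a reflection, the elements of the conjugate diagram are the gaps of \<open>M\<close>, and
  each part counts the gaps below an element.\<close>

lemma maya_partition_conj:
  assumes M: "maya_diagram M"
  shows "maya_partition (maya_conj M) = conj_partition (maya_partition M)"
proof -
  \<comment> \<open>\<open>L\<close> is the largest element in standard position; the reflection
    between the two standard diagrams is then k -> L - k.\<close>
  define D L where "D = maya_std M" and "L = maya_largest M + maya_t M"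
  let ?A = "pos_part D" and ?B = "pos_part (maya_std (maya_conj M))"
  let ?n = "maya_desc M" and ?b = "maya_desc (maya_conj M)" and ?la = "maya_partition M"
  have L: "L \<in> D" "\<And>k. k \<in> D \<Longrightarrow> k \<le> L"
    using maya_largest [OF M] unfolding D_def L_def maya_std_def mem_maya_shift
    by (auto simp: algebra_simps) (metis diff_le_eq add.commute)
  have D: "\<And>k. k < 0 \<Longrightarrow> k \<in> D" using maya_t [OF M] by (simp add: D_def)
  have std: "k \<in> maya_std (maya_conj M) \<longleftrightarrow> L - k \<notin> D" for k
    unfolding D_def L_def maya_std_def maya_t_conj [OF M]
    unfolding mem_maya_shift maya_conj_def
    by (simp add: algebra_simps)
  note n = maya_desc [OF M] and b = maya_desc [OF maya_diagram_conj [OF M]]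
  show ?thesis
  proof (cases "L < 0")
    \<comment> \<open>The standard diagram is the set of all negative integers and both partitions
      are empty.\<close>
    case True
    have "?A = {}" "?B = {}"
      using True L(2) D by (force simp: pos_part_def std)+
    then have "?n = []" "?b = []" using n(1) b(1) by (simp_all add: D_def)
    then show ?thesis by (simp add: maya_partition_eq conj_partition_def)
  next
    case False
    define l where "l = nat L"
    have l: "L = int l" using False by (simp add: l_def)
    have A: "l \<in> ?A" "\<And>a. a \<in> ?A \<Longrightarrow> a \<le> l"
    proof -
      show "l \<in> ?A" using L(1) by (simp add: pos_part_def l)
      show "a \<le> l" if "a \<in> ?A" for a using L(2) [of "int a"] that by (simp add: pos_part_def l)
    qed
    \<comment> \<open>For k > l the reflected position is negative, hence occupied, so
      \<open>?B\<close> lies within {0..l}.\<close>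
    have B: "k \<in> ?B \<longleftrightarrow> k \<le> l \<and> l - k \<notin> ?A" for k
      using D [of "int l - int k"] by (cases "k \<le> l") (auto simp: pos_part_def std l of_nat_diff)
    have la: "?la ! j = card {h \<in> ?B. l - ?n ! j < h}" and nj: "?n ! j \<in> ?A" if "j < length ?n" for j
    proof -
      show nj: "?n ! j \<in> ?A" using n(1) that nth_mem by (auto simp: D_def)
      show "?la ! j = card {h \<in> ?B. l - ?n ! j < h}"
        using maya_partition_nth(2) [OF M that] card_reflect [OF B A(2) [OF nj]] by (simp add: D_def)
    qed
    have ln: "?n \<noteq> []" using A(1) n(1) by (auto simp: D_def)
    have len: "length (conj_partition ?la) = length ?b"
    proof -
      \<comment> \<open>All gaps lie below the largest element, so the first part, which is the
        length of the conjugate, is the number of all gaps.\<close>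
      have "?n ! 0 = l"
      proof -
        obtain i where i: "i < length ?n" "?n ! i = l"
          using A(1) n(1) by (metis D_def in_set_conv_nth)
        moreover have "?n ! 0 \<le> l" using A(2) nj [of 0] ln by simp
        ultimately show ?thesis
          using sorted_wrt_nth_less [OF n(2), of 0 i] by (cases "i = 0") auto
      qed
      moreover have "{h \<in> ?B. 0 < h} = ?B" using A(1) B by (auto intro: gr0I)
      ultimately have "?la ! 0 = card ?B" using la [of 0] ln by simp
      also have "\<dots> = length ?b" using b(1) distinct_maya_desc by (metis distinct_card)
      finally have "?la ! 0 = length ?b" .
      moreover have "?la \<noteq> []" using ln length_maya_partition [of M] by (metis length_0_conv)
      ultimately show ?thesis by (cases ?la) (simp_all add: conj_partition_def del: upt_Suc)
    qed
    show ?thesis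
    proof (rule nth_equalityI)
      show "length (maya_partition (maya_conj M)) = length (conj_partition ?la)" by (simp add: len)
      fix i assume "i < length (maya_partition (maya_conj M))"
      then have i: "i < length ?b" by simp
      have bi: "?b ! i \<in> ?B" using b(1) i nth_mem by auto
      have "maya_partition (maya_conj M) ! i = card ({..<?b ! i} - ?B)"
        by (rule maya_partition_nth(2) [OF maya_diagram_conj [OF M] i])
      also have "\<dots> = card {a \<in> ?A. l - ?b ! i < a}"
      proof (rule card_reflect)
        show "k \<in> ?A \<longleftrightarrow> k \<le> l \<and> l - k \<notin> ?B" for k
          using A(2) [of k] unfolding B by auto
        show "?b ! i \<le> l" using bi unfolding B by simp
      qed
      also have "{a \<in> ?A. l - ?b ! i < a} = (!) ?n ` {j. j < length ?n \<and> i < ?la ! j}"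
      proof -
        \<comment> \<open>Both sides say that the gap l - b_i lies below the element n_j.\<close>
        have "i < ?la ! j \<longleftrightarrow> l - ?b ! i < ?n ! j" if "j < length ?n" for j
        proof -
          have "i < ?la ! j \<longleftrightarrow> l - ?n ! j < ?b ! i"
            using nth_less_iff_card [OF b(2) i] la [OF that] by (simp add: b(1))
          also have "\<dots> \<longleftrightarrow> l - ?b ! i < ?n ! j"
            using A(2) [OF nj [OF that]] bi B by auto
          finally show ?thesis .
        qed
        moreover have "?A = (!) ?n ` {j. j < length ?n}"
          using n(1) by (auto simp: D_def set_conv_nth)
        ultimately show ?thesis by auto
      qed
      also have "card \<dots> = card {j. j < length ?la \<and> i < ?la ! j}"
        using inj_on_nth [OF distinct_maya_desc [of M], of "{j. j < length ?n \<and> i < ?la ! j}"]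
        by (simp add: card_image)
      also have "\<dots> = conj_partition ?la ! i"
        using nth_conj_partition [of i ?la] i len by simp
      finally show "maya_partition (maya_conj M) ! i = conj_partition ?la ! i" .
    qed
  qed
qed


section \<open>Reduction to exceptional Laguerre polynomials\<close>

lemma continuous_on_normalized_wronskian:
  assumes "x > 0"
  shows "continuous_on UNIV (\<lambda>a. normalized_wronskian e a ns ms ms' ns' x)"
  unfolding normalized_wronskian_def using assms by (intro continuous_intros continuous_on_wronskian_seeds) auto

text \<open>The integers are isolated, so a continuous function that vanishes off them vanishes on
  them too. \<open>C\<close> may be 0 in the limit.\<close>

lemma proportional_extend:
  fixes f g :: "real \<Rightarrow> real \<Rightarrow> real"
  assumes generic: "\<And>b. b \<notin> \<int> \<Longrightarrow> proportional (f b) (g b)"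
    and cont: "\<And>x. x > 0 \<Longrightarrow> continuous_on UNIV (\<lambda>b. f b x)" "\<And>x. x > 0 \<Longrightarrow> continuous_on UNIV (\<lambda>b. g b x)"
    and nz: "x\<^sub>0 > 0" "g a x\<^sub>0 \<noteq> 0"
  shows "\<exists>C. \<forall>x>0. f a x = C * g a x"
proof (intro exI allI impI)
  fix x :: real assume x: "x > 0"
  \<comment> \<open>Cross-multiplication removes the constant of proportionality, whose dependence
    on \<open>b\<close> is unknown.\<close>
  let ?h = "\<lambda>b. f b x * g b x\<^sub>0 - f b x\<^sub>0 * g b x"
  have h0: "?h b = 0" if "b \<notin> \<int>" for b
    using generic [OF that] x nz(1) by (auto simp: proportional_def)
  have "continuous_on UNIV ?h"
    using cont x nz(1) by (intro continuous_intros) auto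
  then have "(?h \<longlongrightarrow> ?h a) (at a)"
    by (simp add: continuous_on_def)
  moreover have "\<forall>\<^sub>F b in at a. b \<notin> \<int>"
  proof -
    have "y = x" if "x \<in> \<int>" "y \<in> \<int>" "dist y x < 1" for x y :: real
      using that by (auto elim!: Ints_cases simp: dist_real_def simp flip: of_int_diff of_int_abs)
    then have "\<not> a islimpt \<int>"
      using discrete_imp_not_islimpt [of 1 "\<int> :: real set" a] by auto
    then show ?thesis
      by (simp add: islimpt_iff_eventually)
  qed
  then have "\<forall>\<^sub>F b in at a. ?h b = 0"
    by eventually_elim (rule h0)
  then have "(?h \<longlongrightarrow> 0) (at a)"
    by (simp add: tendsto_eventually)
  ultimately have "?h a = 0"
    by (rule tendsto_unique [OF trivial_limit_at])
  with nz(2) show "f a x = f a x\<^sub>0 / g a x\<^sub>0 * g a x"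
    by (simp add: field_simps)
qed

lemma smooth_on_laguerre:
  "smooth_on UNIV (laguerre a n)" "smooth_on UNIV (\<lambda>x. exp x * laguerre a n (- x))"
  using smooth_on_exp_rat [of UNIV 1 0 "laguerre_poly a n 1"]
    smooth_on_exp_rat [of UNIV 1 1 "laguerre_poly a n (- 1)"]
  by (simp_all add: exp_rat_def poly_laguerre_poly)

lemma map_maya_partition_index:
  assumes "maya_diagram M"
  shows "map (\<lambda>j. F (maya_partition M ! (j - 1) + length (maya_partition M) - j)) [1..<length (maya_partition M) + 1]
    = map F (maya_desc M)"
proof (rule nth_equalityI)
  fix i assume "i < length (map (\<lambda>j. F (maya_partition M ! (j - 1) + length (maya_partition M) - j)) [1..<length (maya_partition M) + 1])"
  then have i: "i < length (maya_desc M)" by (simp del: upt_Suc)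
  then show "map (\<lambda>j. F (maya_partition M ! (j - 1) + length (maya_partition M) - j)) [1..<length (maya_partition M) + 1] ! i
      = map F (maya_desc M) ! i"
    using maya_partition_nth(1) [OF assms i] by (simp del: upt_Suc)
qed (simp del: upt_Suc)

text \<open>Without types three and four the power of \<open>x\<close> has exponent 0, and the
  remaining exponential is that of the exceptional polynomial at \<open>e * x\<close>.\<close>

lemma normalized_wronskian_std:
  assumes M: "maya_diagram M" and N: "maya_diagram N"
    and n: "n + length (maya_partition M) = \<sigma> + sum_list (maya_partition M) + sum_list (maya_partition N)"
  shows "\<exists>C. \<forall>x>0. normalized_wronskian e b (\<sigma> # maya_desc M) (maya_desc N) [] [] x =
    C * exceptional_laguerre b (maya_partition M) (maya_partition N) n (e * x)"
proof -
  let ?G = "map (laguerre b) (maya_desc M) @ map (\<lambda>m x. exp x * laguerre b m (- x)) (maya_desc N) @ [laguerre b \<sigma>]"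
  have \<sigma>: "n + length (maya_partition M) - (sum_list (maya_partition M) + sum_list (maya_partition N)) = \<sigma>"
    using n by simp
  have exc: "exceptional_laguerre b (maya_partition M) (maya_partition N) n y =
      exp (- real (length (maya_desc N)) * y) * wronskian ?G y" for y
    unfolding exceptional_laguerre_def Let_def \<sigma> map_maya_partition_index [OF M]
      map_maya_partition_index [OF N, of "\<lambda>m x. exp x * laguerre b m (- x)"] by simp
  have "mset (seeds e b (\<sigma> # maya_desc M) (maya_desc N) [] []) = mset (map (\<lambda>f y. f (e * y)) ?G)"
    by (simp add: seeds_def o_def)
  from wronskian_permute [OF this] obtain c where
    c: "\<And>x. wronskian (seeds e b (\<sigma> # maya_desc M) (maya_desc N) [] []) x =
      c * wronskian (map (\<lambda>f y. f (e * y)) ?G) x"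
    by blast
  have sc: "wronskian (map (\<lambda>f y. f (e * y)) ?G) x = (\<Prod>j<length ?G. e ^ j) * wronskian ?G (e * x)" for x
    by (rule wronskian_scale) (auto intro: smooth_on_laguerre)
  show ?thesis
  proof (intro exI allI impI)
    fix x :: real assume "x > 0"
    then show "normalized_wronskian e b (\<sigma> # maya_desc M) (maya_desc N) [] [] x = c * (\<Prod>j<length ?G. e ^ j) *
        exceptional_laguerre b (maya_partition M) (maya_partition N) n (e * x)"
      unfolding normalized_wronskian_def c sc exc by (simp add: mult.commute [of e] mult.left_commute [of e])
  qed
qed

lemma mset_sorted_list_of_set: "distinct xs \<Longrightarrow> mset xs = mset (sorted_list_of_set (set xs))"
  by (subst set_eq_iff_mset_eq_distinct [symmetric]) auto

text \<open>For integral \<open>a\<close> the constants of the elementary steps may vanish, so the identity is extended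
  from non-integral \<open>a\<close> by continuity; this needs a point where the right-hand side is nonzero.\<close>

lemma normalized_wronskian_exceptional_laguerre:
  fixes ns ms ms' ns' :: "nat list"
  assumes e: "e \<noteq> 0" and dist: "distinct ns" "distinct ms" "distinct ms'" "distinct ns'"
    and s: "s \<notin> set ns"
  defines "M \<equiv> maya_of ns' ns" and "N \<equiv> maya_of ms' ms"
  defines "la \<equiv> maya_partition M" and "mu \<equiv> maya_partition N"
  obtains n C where
    "int n = int s + maya_t M + int (sum_list la) + int (sum_list mu) - int (length la)"
    "n \<in> degree_seq la mu"
    "\<And>x. x > 0 \<Longrightarrow> normalized_wronskian e a (s # ns) ms ms' ns' x =
      C * exceptional_laguerre (a - of_int (maya_t M) - of_int (maya_t N)) la mu n (e * x)"
proof -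
  define t u where "t = maya_t M" and "u = maya_t N"
  define M' where "M' = insert (int s) M"
  have MN: "maya_diagram M" "maya_diagram N"
    by (simp_all add: M_def N_def maya_diagram_maya_of)
  have sM: "int s \<notin> M" using s by (simp add: M_def mem_maya_of)
  have parts: "pos_part M' = set (s # ns)" "neg_part M' = set ns'" "pos_part N = set ms" "neg_part N = set ms'"
    by (auto simp: M'_def M_def N_def pos_part_def neg_part_def mem_maya_of)
  have M': "maya_diagram M'" by (simp add: maya_diagram_iff parts)
  have "int s + t \<notin> maya_std M" using sM by (simp add: maya_std_def mem_maya_shift t_def)
  \<comment> \<open>In standard position every negative integer is occupied, so the free position s
    + t is a natural number; it becomes the degree \<open>\<sigma>\<close>.\<close>
  then have "int s + t \<ge> 0" using maya_t(1) [OF MN(1)] by (meson not_le)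
  then obtain \<sigma> where \<sigma>: "int s + t = int \<sigma>" by (metis nonneg_int_cases)
  have \<sigma>M: "int \<sigma> \<notin> maya_std M" using \<open>int s + t \<notin> maya_std M\<close> \<sigma> by simp
  \<comment> \<open>The shift is that of \<open>M\<close>, not of \<open>M'\<close>: the added
    element lands at \<open>\<sigma>\<close>, possibly 0, and no negative hole remains.\<close>
  have shift: "maya_shift M' t = insert (int \<sigma>) (maya_std M)" "maya_shift N u = maya_std N"
    by (auto simp: M'_def maya_std_def t_def u_def mem_maya_shift \<sigma> [unfolded t_def, symmetric])
  define R where "R = (\<lambda>b. normalized_wronskian e (b - of_int t - of_int u) (\<sigma> # maya_desc M) (maya_desc N) [] [])"
  have dM: "distinct (\<sigma> # maya_desc M)"
    using \<sigma>M distinct_maya_desc by (simp add: maya_desc(1) [OF MN(1)] pos_part_def)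
  have generic: "proportional (normalized_wronskian e b (s # ns) ms ms' ns') (R b)" if b: "b \<notin> \<int>" for b
  proof -
    have "proportional (normalized_wronskian e b (s # ns) ms ms' ns') (maya_wronskian e b M' N)"
      unfolding maya_wronskian_def parts using dist s by (intro normalized_wronskian_permute mset_sorted_list_of_set) auto
    also have "proportional \<dots> (maya_wronskian e (b - of_int t - of_int u) (insert (int \<sigma>) (maya_std M)) (maya_std N))"
      unfolding shift [symmetric] using b e M' MN by (intro maya_wronskian_shift)
    also have "proportional \<dots> (R b)"
    proof -
      have "pos_part (insert (int \<sigma>) (maya_std M)) = set (\<sigma> # maya_desc M)" "pos_part (maya_std N) = set (maya_desc N)"
        using maya_desc(1) [OF MN(1)] maya_desc(1) [OF MN(2)] by (auto simp: pos_part_def)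
      moreover have "neg_part (insert (int \<sigma>) (maya_std M)) = {}" "neg_part (maya_std N) = {}"
        using maya_t(1) [OF MN(1)] maya_t(1) [OF MN(2)] by (auto simp: neg_part_def)
      ultimately show ?thesis
        unfolding maya_wronskian_def R_def using dM distinct_maya_desc
        by (simp only: sorted_list_of_set_empty) (intro normalized_wronskian_permute mset_sorted_list_of_set [symmetric] refl; simp)
    qed
    finally show ?thesis .
  qed
  define \<beta> where "\<beta> = a - of_int t - of_int u"
  obtain x\<^sub>0 where x0: "x\<^sub>0 > 0" "wronskian (seeds e \<beta> (\<sigma> # maya_desc M) (maya_desc N) [] []) x\<^sub>0 \<noteq> 0"
    using wronskian_seeds_nonzero [OF e dM distinct_maya_desc] by blast
  have "\<exists>C. \<forall>x>0. normalized_wronskian e a (s # ns) ms ms' ns' x = C * R a x"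
  proof (rule proportional_extend [OF generic])
    show "continuous_on UNIV (\<lambda>b. normalized_wronskian e b (s # ns) ms ms' ns' x)" if "x > 0" for x
      using that by (rule continuous_on_normalized_wronskian)
    show "continuous_on UNIV (\<lambda>b. R b x)" if "x > 0" for x
      unfolding R_def
      by (rule continuous_on_compose2 [OF continuous_on_normalized_wronskian [OF that]]) (auto intro!: continuous_intros)
    show "x\<^sub>0 > 0" "R a x\<^sub>0 \<noteq> 0" using x0 by (simp_all add: R_def normalized_wronskian_def \<beta>_def)
  qed
  then obtain C where C: "\<And>x. x > 0 \<Longrightarrow> normalized_wronskian e a (s # ns) ms ms' ns' x = C * R a x" by blast
  \<comment> \<open>Parts are positive; this makes \<open>n\<close> a natural number.\<close>
  have "length la \<le> sum_list la"
  proof -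
    have "\<forall>k\<in>set la. 1 \<le> k"
      using is_partition_maya_partition [OF MN(1)] by (auto simp: is_partition_def la_def Suc_le_eq)
    then show ?thesis by (induction la) auto
  qed
  then obtain n where n: "n + length la = \<sigma> + sum_list la + sum_list mu"
    by (metis add.assoc add.commute le_add_diff_inverse2 trans_le_add2)
  obtain K where K: "\<And>x. x > 0 \<Longrightarrow> normalized_wronskian e \<beta> (\<sigma> # maya_desc M) (maya_desc N) [] [] x =
      K * exceptional_laguerre \<beta> la mu n (e * x)"
    using normalized_wronskian_std [OF MN n [unfolded la_def mu_def], of e \<beta>] unfolding la_def mu_def by blast
  show thesis
  proof (rule that [of n "C * K"])
    show "int n = int s + maya_t M + int (sum_list la) + int (sum_list mu) - int (length la)"
      using n \<sigma> unfolding t_def by linarith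
    show "n \<in> degree_seq la mu"
      unfolding degree_seq_def
    proof (intro CollectI conjI ballI)
      show "int n \<ge> int (sum_list la) + int (sum_list mu) - int (length la)" using n by linarith
      fix j assume "j \<in> {1..length la}"
      then obtain i where i: "j = Suc i" "i < length (maya_desc M)"
        by (cases j) (auto simp: la_def)
      \<comment> \<open>The excluded degrees are exactly those for which \<open>\<sigma>\<close>
        would repeat an element of the diagram.\<close>
      have "maya_desc M ! i \<noteq> \<sigma>" using dM i(2) nth_mem by fastforce
      then show "int n - int (sum_list la) - int (sum_list mu) \<noteq> int (la ! (j - 1)) - int j"
        using maya_partition_nth(1) [OF MN(1) i(2)] n length_maya_partition [of M] unfolding i(1) la_def by simp
    qed
    show "normalized_wronskian e a (s # ns) ms ms' ns' x =
        C * K * exceptional_laguerre (a - of_int (maya_t M) - of_int (maya_t N)) la mu n (e * x)"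
      if "x > 0" for x
      using C [OF that] K [of x] that by (simp add: R_def \<beta>_def t_def u_def)
  qed
qed


section \<open>The four claims as instances of one\<close>

lemma normalized_wronskian_of_mset_eq:
  assumes "mset hs = mset (seeds 1 a ns ms ms' ns')"
  shows "\<exists>C. \<forall>x. exp (- (real (length ms) + real (length ns')) * x)
      * x powr ((a + real (length ns) + real (length ms)) * (real (length ms') + real (length ns')))
      * wronskian hs x = C * normalized_wronskian 1 a ns ms ms' ns' x"
proof -
  obtain c where "\<And>x. wronskian hs x = c * wronskian (seeds 1 a ns ms ms' ns') x"
    using wronskian_permute [OF assms] by blast
  then show ?thesis by (intro exI [of _ c]) (simp add: normalized_wronskian_def left_diff_distrib distrib_right)
qed

text \<open>Common form of (a) to (d): the first hypothesis takes the symmetry that turns the added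
  function into a seed of type one.\<close>

lemma proportional_imp_exceptional_laguerre:
  assumes "proportional f (normalized_wronskian e a (s # ns) ms ms' ns')"
    and e: "e \<noteq> 0" and dist: "distinct ns" "distinct ms" "distinct ms'" "distinct ns'" "s \<notin> set ns"
    and M: "M = maya_of ns' ns" and N: "N = maya_of ms' ms"
    and la: "la = maya_partition M" and mu: "mu = maya_partition N"
    and b: "b = a - of_int (maya_t M) - of_int (maya_t N)"
    and g: "\<And>x. x > 0 \<Longrightarrow> g x = K * f x"
  shows "\<exists>n. int n = int s + maya_t M + int (sum_list la) + int (sum_list mu) - int (length la) \<and>
    n \<in> degree_seq la mu \<and> (\<exists>C. \<forall>x>0. g x = C * exceptional_laguerre b la mu n (e * x))"
proof -
  obtain n C where n: "int n = int s + maya_t M + int (sum_list la) + int (sum_list mu) - int (length la)"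
      "n \<in> degree_seq la mu"
    and C: "\<And>x. x > 0 \<Longrightarrow> normalized_wronskian e a (s # ns) ms ms' ns' x = C * exceptional_laguerre b la mu n (e * x)"
    using normalized_wronskian_exceptional_laguerre [OF e dist, of a] unfolding M N la mu b by blast
  obtain D where "\<And>x. x > 0 \<Longrightarrow> f x = D * normalized_wronskian e a (s # ns) ms ms' ns' x"
    using assms(1) by (auto simp: proportional_def)
  then have "g x = K * D * C * exceptional_laguerre b la mu n (e * x)" if "x > 0" for x
    using C g that by simp
  with n show ?thesis by blast
qed

theorem proposition5p1:
  fixes \<alpha> \<alpha>' :: real
    and r1 r2 r3 r4 s :: nat
    and ns ms ms' ns' :: "nat list"
    and fs :: "(real \<Rightarrow> real) list"
    and M1 M2 :: "int set"
    and la mu la' mu' :: "nat list"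
    and t1 t2 n1 m1 :: int
  assumes "sorted_wrt (>) ns" and "length ns = r1"
    and "sorted_wrt (>) ms" and "length ms = r2"
    and "sorted_wrt (>) ms'" and "length ms' = r3"
    and "sorted_wrt (>) ns'" and "length ns' = r4"
    and "fs =
      map (\<lambda>n. laguerre \<alpha> n) ns @
      map (\<lambda>m x. exp x * laguerre \<alpha> m (- x)) ms @
      map (\<lambda>m x. x powr (- \<alpha>) * laguerre (- \<alpha>) m x) ms' @
      map (\<lambda>n x. exp x * x powr (- \<alpha>) * laguerre (- \<alpha>) n (- x)) ns'"
    and "M1 = maya_of ns' ns" and "M2 = maya_of ms' ms"
    and "la = maya_partition M1" and "mu = maya_partition M2"
    and "la' = conj_partition la" and "mu' = conj_partition mu"
    and "t1 = maya_t M1" and "t2 = maya_t M2"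
    and "n1 = maya_largest M1" and "m1 = maya_largest M2"
    and "\<alpha>' = \<alpha> + of_int n1 + of_int m1 + 2"
  shows
    "(s \<notin> set ns \<longrightarrow>
       (\<exists>n::nat. int n = int s + t1 + int (sum_list la) + int (sum_list mu) - int (length la) \<and>
         n \<in> degree_seq la mu \<and>
         (\<exists>C1::real. \<forall>x>0.
           exp (- (real r2 + real r4) * x)
             * x powr ((\<alpha> + real r1 + 1 + real r2) * (real r3 + real r4))
             * wronskian (fs @ [laguerre \<alpha> s]) x
           = C1 * exceptional_laguerre (\<alpha> - of_int t1 - of_int t2) la mu n x)))
     \<and>
     (s \<notin> set ms \<longrightarrow>
       (\<exists>n::nat. int n = int s + t2 + int (sum_list la) + int (sum_list mu) - int (length mu) \<and>
         n \<in> degree_seq mu la \<and>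
         (\<exists>C2::real. \<forall>x>0.
           exp (- (real r2 + 1 + real r4) * x)
             * x powr ((\<alpha> + real r1 + real r2 + 1) * (real r3 + real r4))
             * wronskian (fs @ [\<lambda>x. exp x * laguerre \<alpha> s (- x)]) x
           = C2 * exceptional_laguerre (\<alpha> - of_int t1 - of_int t2) mu la n (- x))))
     \<and>
     (s \<notin> set ms' \<longrightarrow>
       (\<exists>n::nat. int n = int s + m1 + 1 + int (sum_list la) + int (sum_list mu) - int (length mu') \<and>
         n \<in> degree_seq mu' la' \<and>
         (\<exists>C3::real. \<forall>x>0.
           exp (- (real r2 + real r4) * x)
             * x powr ((\<alpha> + real r1 + real r2) * (real r3 + 1 + real r4))
             * wronskian (fs @ [\<lambda>x. x powr (- \<alpha>) * laguerre (- \<alpha>) s x]) x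
           = C3 * exceptional_laguerre (- \<alpha>') mu' la' n x)))
     \<and>
     (s \<notin> set ns' \<longrightarrow>
       (\<exists>n::nat. int n = int s + n1 + 1 + int (sum_list la) + int (sum_list mu) - int (length la') \<and>
         n \<in> degree_seq la' mu' \<and>
         (\<exists>C4::real. \<forall>x>0.
           exp (- (real r2 + real r4 + 1) * x)
             * x powr ((\<alpha> + real r1 + real r2) * (real r3 + real r4 + 1))
             * wronskian (fs @ [\<lambda>x. exp x * x powr (- \<alpha>) * laguerre (- \<alpha>) s (- x)]) x
           = C4 * exceptional_laguerre (- \<alpha>') la' mu' n (- x))))"
proof -
  note fs = assms(9) and M = assms(10,11) and la = assms(12,13) and la' = assms(14,15)
    and t = assms(16,17) and n1 = assms(18,19) and \<alpha>' = assms(20)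
  have len: "length ns = r1" "length ms = r2" "length ms' = r3" "length ns' = r4"
    using assms by simp_all
  have "distinct xs" if "sorted_wrt (>) xs" for xs :: "nat list"
    using that by (induction xs) auto
  then have dist: "distinct ns" "distinct ms" "distinct ms'" "distinct ns'"
    using assms by blast+
  have maya: "maya_diagram M1" "maya_diagram M2"
    by (simp_all add: M maya_diagram_maya_of)
  have conj: "la' = maya_partition (maya_of ns ns')" "mu' = maya_partition (maya_of ms ms')"
    unfolding la' la maya_partition_conj [OF maya(1), symmetric] maya_partition_conj [OF maya(2), symmetric]
    by (simp_all add: M maya_conj_maya_of)
  have tconj: "maya_t (maya_of ns ns') = n1 + 1" "maya_t (maya_of ms ms') = m1 + 1"
    using maya_t_conj [OF maya(1)] maya_t_conj [OF maya(2)] by (simp_all add: M n1 maya_conj_maya_of)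
  have sums: "sum_list la' = sum_list la" "sum_list mu' = sum_list mu"
    unfolding la' la using maya by (simp_all add: sum_list_conj_partition is_partition_maya_partition)
  show ?thesis
  proof (intro conjI impI)
    assume s: "s \<notin> set ns"
    have "mset (fs @ [laguerre \<alpha> s]) = mset (seeds 1 \<alpha> (s # ns) ms ms' ns')"
      by (simp add: fs seeds_def)
    from normalized_wronskian_of_mset_eq [OF this] obtain K where K: "\<And>x. exp (- (real (length ms) + real (length ns')) * x)
      * x powr ((\<alpha> + real (length (s # ns)) + real (length ms)) * (real (length ms') + real (length ns')))
      * wronskian (fs @ [laguerre \<alpha> s]) x = K * normalized_wronskian 1 \<alpha> (s # ns) ms ms' ns' x"
      by blast
    have "\<exists>n. int n = int s + maya_t M1 + int (sum_list la) + int (sum_list mu) - int (length la) \<and>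
      n \<in> degree_seq la mu \<and> (\<exists>C. \<forall>x>0. exp (- (real r2 + real r4) * x)
        * x powr ((\<alpha> + real r1 + 1 + real r2) * (real r3 + real r4))
        * wronskian (fs @ [laguerre \<alpha> s]) x = C * exceptional_laguerre (\<alpha> - t1 - t2) la mu n (1 * x))"
      by (rule proportional_imp_exceptional_laguerre [OF proportional_refl _ dist s])
        (use K in \<open>simp_all add: M la t len ac_simps\<close>)
    then show "\<exists>n::nat. int n = int s + t1 + int (sum_list la) + int (sum_list mu) - int (length la) \<and>
      n \<in> degree_seq la mu \<and> (\<exists>C1::real. \<forall>x>0. exp (- (real r2 + real r4) * x)
        * x powr ((\<alpha> + real r1 + 1 + real r2) * (real r3 + real r4))
        * wronskian (fs @ [laguerre \<alpha> s]) x
        = C1 * exceptional_laguerre (\<alpha> - of_int t1 - of_int t2) la mu n x)"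
      by (simp add: t)
  next
    assume s: "s \<notin> set ms"
    let ?hs = "fs @ [\<lambda>x. exp x * laguerre \<alpha> s (- x)]"
    have "mset ?hs = mset (seeds 1 \<alpha> ns (s # ms) ms' ns')"
      by (simp add: fs seeds_def)
    from normalized_wronskian_of_mset_eq [OF this] obtain K where K: "\<And>x. exp (- (real (length (s # ms)) + real (length ns')) * x)
      * x powr ((\<alpha> + real (length ns) + real (length (s # ms))) * (real (length ms') + real (length ns')))
      * wronskian ?hs x = K * normalized_wronskian 1 \<alpha> ns (s # ms) ms' ns' x"
      by blast
    have "\<exists>n. int n = int s + maya_t M2 + int (sum_list mu) + int (sum_list la) - int (length mu) \<and>
      n \<in> degree_seq mu la \<and> (\<exists>C. \<forall>x>0. exp (- (real r2 + 1 + real r4) * x)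
        * x powr ((\<alpha> + real r1 + real r2 + 1) * (real r3 + real r4))
        * wronskian ?hs x = C * exceptional_laguerre (\<alpha> - t1 - t2) mu la n (- 1 * x))"
      \<comment> \<open>The swap turns type two into type one and leaves e = -1, whence the argument
        -x.\<close>
      by (rule proportional_imp_exceptional_laguerre [OF normalized_wronskian_swap _ dist(2,1,4,3) s])
        (use K in \<open>simp_all add: M la t len ac_simps\<close>)
    then show "\<exists>n::nat. int n = int s + t2 + int (sum_list la) + int (sum_list mu) - int (length mu) \<and>
      n \<in> degree_seq mu la \<and> (\<exists>C2::real. \<forall>x>0. exp (- (real r2 + 1 + real r4) * x)
        * x powr ((\<alpha> + real r1 + real r2 + 1) * (real r3 + real r4))
        * wronskian ?hs x
        = C2 * exceptional_laguerre (\<alpha> - of_int t1 - of_int t2) mu la n (- x))"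
      by (simp add: t ac_simps)
  next
    assume s: "s \<notin> set ms'"
    let ?hs = "fs @ [\<lambda>x. x powr (- \<alpha>) * laguerre (- \<alpha>) s x]"
    have "mset ?hs = mset (seeds 1 \<alpha> ns ms (s # ms') ns')"
      by (simp add: fs seeds_def)
    from normalized_wronskian_of_mset_eq [OF this] obtain K where K: "\<And>x. exp (- (real (length ms) + real (length ns')) * x)
      * x powr ((\<alpha> + real (length ns) + real (length ms)) * (real (length (s # ms')) + real (length ns')))
      * wronskian ?hs x = K * normalized_wronskian 1 \<alpha> ns ms (s # ms') ns' x"
      by blast
    have "\<exists>n. int n = int s + maya_t (maya_of ms ms') + int (sum_list mu') + int (sum_list la') - int (length mu') \<and>
      n \<in> degree_seq mu' la' \<and> (\<exists>C. \<forall>x>0. exp (- (real r2 + real r4) * x)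
        * x powr ((\<alpha> + real r1 + real r2) * (real r3 + 1 + real r4))
        * wronskian ?hs x = C * exceptional_laguerre (- \<alpha>') mu' la' n (1 * x))"
      \<comment> \<open>Type three becomes type one at parameter -\<alpha>, with the conjugate of
        \<open>M2\<close> first; the two shifts give -\<alpha> - (m_1 + 1) - (n_1 + 1) =
        -\<alpha>'.\<close>
      by (rule proportional_imp_exceptional_laguerre [OF normalized_wronskian_neg _ dist(3,4,1,2) s refl refl conj(2,1)])
        (use K in \<open>simp_all add: tconj \<alpha>' len ac_simps\<close>)
    then show "\<exists>n::nat. int n = int s + m1 + 1 + int (sum_list la) + int (sum_list mu) - int (length mu') \<and>
      n \<in> degree_seq mu' la' \<and> (\<exists>C3::real. \<forall>x>0. exp (- (real r2 + real r4) * x)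
        * x powr ((\<alpha> + real r1 + real r2) * (real r3 + 1 + real r4))
        * wronskian ?hs x
        = C3 * exceptional_laguerre (- \<alpha>') mu' la' n x)"
      by (simp add: tconj sums ac_simps)
  next
    assume s: "s \<notin> set ns'"
    let ?hs = "fs @ [\<lambda>x. exp x * x powr (- \<alpha>) * laguerre (- \<alpha>) s (- x)]"
    have "mset ?hs = mset (seeds 1 \<alpha> ns ms ms' (s # ns'))"
      by (simp add: fs seeds_def)
    from normalized_wronskian_of_mset_eq [OF this] obtain K where K: "\<And>x. exp (- (real (length ms) + real (length (s # ns'))) * x)
      * x powr ((\<alpha> + real (length ns) + real (length ms)) * (real (length ms') + real (length (s # ns'))))
      * wronskian ?hs x = K * normalized_wronskian 1 \<alpha> ns ms ms' (s # ns') x"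
      by blast
    have "\<exists>n. int n = int s + maya_t (maya_of ns ns') + int (sum_list la') + int (sum_list mu') - int (length la') \<and>
      n \<in> degree_seq la' mu' \<and> (\<exists>C. \<forall>x>0. exp (- (real r2 + real r4 + 1) * x)
        * x powr ((\<alpha> + real r1 + real r2) * (real r3 + real r4 + 1))
        * wronskian ?hs x = C * exceptional_laguerre (- \<alpha>') la' mu' n (- 1 * x))"
      \<comment> \<open>Type four needs both symmetries; the swap restores the order of the
        conjugate diagrams.\<close>
      by (rule proportional_imp_exceptional_laguerre
          [OF proportional_trans [OF normalized_wronskian_neg normalized_wronskian_swap] _ dist(4,3,2,1) s refl refl conj])
        (use K in \<open>simp_all add: tconj \<alpha>' len ac_simps\<close>)
    then show "\<exists>n::nat. int n = int s + n1 + 1 + int (sum_list la) + int (sum_list mu) - int (length la') \<and>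
      n \<in> degree_seq la' mu' \<and> (\<exists>C4::real. \<forall>x>0. exp (- (real r2 + real r4 + 1) * x)
        * x powr ((\<alpha> + real r1 + real r2) * (real r3 + real r4 + 1))
        * wronskian ?hs x
        = C4 * exceptional_laguerre (- \<alpha>') la' mu' n (- x))"
      by (simp add: tconj sums ac_simps)
  qed
qed

end
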